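(* For every $k\ge 2$, the field extension $\mathbb{Q}(d_k)/\mathbb{Q}$ (equivalently $\mathbb{Q}(d_k-2)/\mathbb{Q}$) is not a Galois extension. Consequently, $d_k$ is not a cyclotomic integer (it is not contained in any cyclotomic field).
   Context: Define $q_k(x)\in\mathbb{Z}[x]$ by $q_0(x)=x^2-5x+3$, $q_1(x)=(x^3-8x^2+17x-5)(x-1)$, and $q_k(x)=(x^2-4x+2)q_{k-1}(x)-q_{k-2}(x)$ for $k\ge 2$, and let $d_k$ be the largest real root of $q_k$. (In the source, $d_k$ is the square of the Perron–Frobenius eigenvalue of the graph $\Gamma_k$ in Haagerup's list, and the theorem is used with the Etingof–Nikshych–Ostrik cyclotomicity theorem to conclude that $\Gamma_k$ is not a principal graph of a subfactor for $k\ge 2$.) *)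

theory Defs
  imports "HOL-Computational_Algebra.Computational_Algebra"
begin

fun q :: "nat \<Rightarrow> int poly" where
  "q 0 = [:3, -5, 1:]"
| "q (Suc 0) = [:-5, 17, -8, 1:] * [:-1, 1:]"
| "q (Suc (Suc k)) = [:2, -4, 1:] * q (Suc k) - q k"

definition d :: "nat \<Rightarrow> real" where
  "d k = Max {x :: real. poly (map_poly of_int (q k)) x = 0}"

definition is_subfield :: "complex set \<Rightarrow> bool" where
  "is_subfield F \<longleftrightarrow> 0 \<in> F \<and> 1 \<in> F \<and>
     (\<forall>x\<in>F. \<forall>y\<in>F. x + y \<in> F \<and> x - y \<in> F \<and> x * y \<in> F) \<and>
     (\<forall>x\<in>F. x \<noteq> 0 \<longrightarrow> inverse x \<in> F)"

definition gen_field :: "complex set \<Rightarrow> complex set" where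
  "gen_field S = \<Inter>{F. is_subfield F \<and> S \<subseteq> F}"

definition rat_algebraic :: "complex \<Rightarrow> bool" where
  "rat_algebraic x \<longleftrightarrow> (\<exists>p :: rat poly. p \<noteq> 0 \<and> poly (map_poly of_rat p) x = 0)"

definition normal_over_Q :: "complex set \<Rightarrow> bool" where
  "normal_over_Q K \<longleftrightarrow> (\<forall>p :: rat poly. irreducible p \<longrightarrow>
     (\<exists>x\<in>K. poly (map_poly of_rat p) x = 0) \<longrightarrow>
     (\<forall>z. poly (map_poly of_rat p) z = 0 \<longrightarrow> z \<in> K))"

definition separable_over_Q :: "complex set \<Rightarrow> bool" where
  "separable_over_Q K \<longleftrightarrow> (\<forall>x\<in>K. \<exists>p :: rat poly. irreducible p \<and>
     poly (map_poly of_rat p) x = 0 \<and> coprime p (pderiv p))"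

definition galois_over_Q :: "complex set \<Rightarrow> bool" where
  "galois_over_Q K \<longleftrightarrow> is_subfield K \<and> (\<forall>x\<in>K. rat_algebraic x) \<and>
     normal_over_Q K \<and> separable_over_Q K"

definition cyclotomic_field :: "nat \<Rightarrow> complex set" where
  "cyclotomic_field n = gen_field {cis (2 * pi / real n)}"

end

theory Submission
  imports Defs "HOL-Computational_Algebra.Field_as_Ring"
begin

text \<open>
  Put \<open>x = 4 (cos t)\<^sup>2\<close> and \<open>N = 4 k + 5\<close>. Then \<open>sin (4 t) q k = 2 (cos (N t) sin (3 t) - sin (N t) cos t)\<close>,
  so all roots of \<open>q k\<close> are real and simple, and all but \<open>d k\<close> lie in the interval from 0 to 4.

  Write \<open>q k = P C\<close> with \<open>P\<close> the minimal polynomial of \<open>d k\<close>, and let \<open>D = x\<^sup>3 - 6 x\<^sup>2 + 8 x - 4\<close>. As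
  \<open>q k\<close> divides \<open>4 + D (qc k)\<^sup>2\<close>, the resultant of \<open>C\<close> and \<open>D\<close> divides 64; being odd, it is a unit. But
  \<open>\<bar>D x\<bar> = x + (x - 1)\<^sup>2 (4 - x)\<close> between 0 and 4, and the product of the roots of \<open>C\<close> is a nonzero integer, so
  every root of \<open>C\<close> is 1.

  Let \<open>p\<close> be a prime divisor of \<open>q k 0 = 2 k + 3\<close> (with 9 dividing \<open>2 k + 3\<close> if \<open>p = 3\<close>). Then 0 is a
  simple root of \<open>P\<close> modulo \<open>p\<close>. If all conjugates of \<open>d k\<close> lay in the field generated by \<open>d k\<close>, then lifting
  this root to a \<open>p\<close>-adic one would show that \<open>P\<close>, hence \<open>q k\<close>, splits into linear factors modulo \<open>p\<close>. The only
  multiple root of \<open>q k\<close> modulo \<open>p\<close> is 6, with multiplicity at most 2, so \<open>2 k + 2 \<le> p + 1\<close>, which forces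
  \<open>p = 2 k + 3\<close>. In that case Chebyshev polynomials modulo \<open>p\<close> show that only 0, 1, 2 and 4 can be roots in the prime
  field, which is too few.

  For an element of a cyclotomic field, the conjugates are again polynomials in that element, because the
  automorphisms commute.
\<close>

subsection \<open>Trigonometric identities for the polynomials\<close>

text \<open>With \<open>x = 4 (cos t)\<^sup>2\<close> and \<open>N = 4 k + 5\<close>, \<open>qc k\<close> is \<open>cos (N t) / cos t\<close> and \<open>qs k\<close> is
  \<open>sin (N t) / sin t\<close>.\<close>

fun qc :: "nat \<Rightarrow> int poly" where
  "qc 0 = [:5, -5, 1:]"
| "qc (Suc 0) = [:2, -4, 1:] * [:5, -5, 1:] - 1"
| "qc (Suc (Suc k)) = [:2, -4, 1:] * qc (Suc k) - qc k"

fun qs :: "nat \<Rightarrow> int poly" where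
  "qs 0 = [:1, -3, 1:]"
| "qs (Suc 0) = [:2, -4, 1:] * [:1, -3, 1:] - 1"
| "qs (Suc (Suc k)) = [:2, -4, 1:] * qs (Suc k) - qs k"

abbreviation (input) X :: "int poly" where "X \<equiv> [:0, 1:]"

text \<open>\<open>Dp\<close> is \<open>- 4 ((sin (3 t))\<^sup>2 + (cos t)\<^sup>2)\<close>.\<close>

definition Dp :: "int poly" where "Dp = [:-4, 8, -6, 1:]"

lemma poly_eq_X: "[:2, -4, 1:] = X\<^sup>2 - 4 * X + (2 :: int poly)" "[:-2, 1:] = X - (2 :: int poly)"
  "[:-1, 1:] = X - (1 :: int poly)" "[:4, -1:] = 4 - (X :: int poly)"
  "Dp = X ^ 3 - 6 * X\<^sup>2 + 8 * X - 4"
  by (simp_all add: Dp_def numeral_poly power2_eq_square power3_eq_cube one_pCons)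

text \<open>All three sequences obey the same three-term recurrence, so two initial cases suffice.
  As \<open>X - 1\<close> is sin(3t)/sin(t) and \<open>X - 2\<close> is 2 cos(2t), multiplying by
  sin(t) cos(t) gives the closed formula for \<open>q k\<close>.\<close>

lemma q_eq_qc_qs: "(X - 2) * q k = (X - 1) * qc k - qs k"
proof (induction k rule: q.induct)
  case (3 k)
  then show ?case unfolding q.simps(3) qc.simps(3) qs.simps(3) poly_eq_X by algebra
qed (simp_all add: numeral_poly one_pCons)

text \<open>These are the addition formulas for the angle Nt + 4t, doubled to keep integer
  coefficients: \<open>X\<^sup>2 - 4 * X + 2\<close> is 2 cos(4t).\<close>

lemma qc_qs_step:
  "2 * qc (Suc k) = (X\<^sup>2 - 4 * X + 2) * qc k - (4 - X) * (X - 2) * qs k"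
  "2 * qs (Suc k) = (X\<^sup>2 - 4 * X + 2) * qs k + X * (X - 2) * qc k"
proof (induction k rule: q.induct)
  case (3 k)
  {
    case 1
    show ?case using 3 unfolding qc.simps(3) qs.simps(3) poly_eq_X by algebra
  next
    case 2
    show ?case using 3 unfolding qc.simps(3) qs.simps(3) poly_eq_X by algebra
  }
qed (simp_all add: numeral_poly one_pCons power2_eq_square)

text \<open>The Pythagorean identity for the angle Nt, times 4. Each step of
  \<open>qc_qs_step\<close> is a rotation and preserves the quadratic form.\<close>

lemma qc_qs_pell: "X * (qc k)\<^sup>2 + (4 - X) * (qs k)\<^sup>2 = 4"
proof (induction k)
  case 0
  then show ?case by (simp add: numeral_poly one_pCons power2_eq_square)
next
  case (Suc k)
  have "4 * (X * (qc (Suc k))\<^sup>2 + (4 - X) * (qs (Suc k))\<^sup>2)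
      = X * (2 * qc (Suc k))\<^sup>2 + (4 - X) * (2 * qs (Suc k))\<^sup>2" by algebra
  also have "\<dots> = 4 * (X * (qc k)\<^sup>2 + (4 - X) * (qs k)\<^sup>2)"
    unfolding qc_qs_step by algebra
  also have "\<dots> = 4 * 4" by (simp only: Suc.IH)
  finally have "4 * (X * (qc (Suc k))\<^sup>2 + (4 - X) * (qs (Suc k))\<^sup>2) = 4 * 4" .
  then show ?case by (metis mult_cancel_left zero_neq_numeral)
qed

text \<open>Modulo \<open>q k\<close>, \<open>qs k\<close> equals \<open>(X - 1) * qc k\<close>, so
  the Pell identity becomes an equation in \<open>qc k\<close> alone; its coefficient
  \<open>X + (4 - X) * (X - 1)\<^sup>2\<close> is \<open>- Dp\<close>.\<close>

lemma four_plus_Dp_qc: "4 + Dp * (qc k)\<^sup>2 = q k * ((4 - X) * (X - 2) * ((X - 2) * q k - 2 * (X - 1) * qc k))"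
proof -
  have qs: "qs k = (X - 1) * qc k - (X - 2) * q k" using q_eq_qc_qs[of k] by algebra
  have "4 + Dp * (qc k)\<^sup>2 = X * (qc k)\<^sup>2 + (4 - X) * (qs k)\<^sup>2 + Dp * (qc k)\<^sup>2"
    by (simp only: qc_qs_pell)
  then show ?thesis unfolding qs poly_eq_X by algebra
qed

lemma pderiv_X: "pderiv X = 1" by (simp add: pderiv_pCons)

text \<open>The chain rule for cos(Nt)/cos(t) and sin(Nt)/sin(t), where dx/dt = -8 sin(t)
  cos(t).\<close>

lemma pderiv_qc_qs:
  "2 * X * pderiv (qc k) = of_nat (4 * k + 5) * qs k - qc k"
  "2 * (4 - X) * pderiv (qs k) = qs k - of_nat (4 * k + 5) * qc k"
proof (induction k)
  case 0
  {
    case 1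
    show ?case by (simp add: numeral_poly one_pCons pderiv_pCons)
  next
    case 2
    show ?case by (simp add: numeral_poly one_pCons pderiv_pCons)
  }
next
  case (Suc k)
  note dsimps = pderiv_mult pderiv_add pderiv_diff pderiv_X pderiv_numeral power2_eq_square
  have d1: "2 * pderiv (qc (Suc k)) = (2 * X - 4) * qc k + (X\<^sup>2 - 4 * X + 2) * pderiv (qc k)
      + (X - 2) * qs k - (4 - X) * qs k - (4 - X) * (X - 2) * pderiv (qs k)"
    using arg_cong[OF qc_qs_step(1)[of k], of pderiv]
    by (simp only: dsimps) algebra
  have d2: "2 * pderiv (qs (Suc k)) = (2 * X - 4) * qs k + (X\<^sup>2 - 4 * X + 2) * pderiv (qs k)
      + (2 * X - 2) * qc k + X * (X - 2) * pderiv (qc k)"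
    using arg_cong[OF qc_qs_step(2)[of k], of pderiv]
    by (simp only: dsimps) algebra
  define N :: "int poly" where "N = of_nat (4 * k + 5)"
  have N': "of_nat (4 * Suc k + 5) = N + 4" by (simp add: N_def)
  {
    case 1
    have "2 * (2 * X * pderiv (qc (Suc k))) = 2 * ((N + 4) * qs (Suc k) - qc (Suc k))"
      using d1 qc_qs_step[of k] Suc[folded N_def] by algebra
    then show ?case unfolding N' by (metis mult_cancel_left zero_neq_numeral)
  next
    case 2
    have "2 * (2 * (4 - X) * pderiv (qs (Suc k))) = 2 * (qs (Suc k) - (N + 4) * qc (Suc k))"
      using d2 qc_qs_step[of k] Suc[folded N_def] by algebra
    then show ?case unfolding N' by (metis mult_cancel_left zero_neq_numeral)
  }
qed

text \<open>\<open>Kp k\<close> is the determinant of the linear system for \<open>cos (N t)\<close> and \<open>sin (N t)\<close> expressing that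
  \<open>q k\<close> and its derivative vanish, so multiple roots modulo a prime are roots of \<open>Kp k\<close>.\<close>

definition Kp :: "nat \<Rightarrow> int poly" where
  "Kp k = of_nat (4 * k + 6) * Dp - X * (X - 2) * (X - 6)"

text \<open>Differentiating \<open>q_eq_qc_qs\<close> and eliminating \<open>qs k\<close> and the
  derivatives of \<open>qc k\<close> and \<open>qs k\<close> leaves this. Since 4k + 6 = 2(2k + 3),
  modulo a divisor of 2k + 3 only the term \<open>X * (X - 2) * (X - 6)\<close> of
  \<open>Kp k\<close> survives.\<close>

lemma Kp_mult_qc: "Kp k * qc k = - (2 * X * (4 - X) * (X - 2)) * pderiv (q k)
   - (2 * X * (4 - X) + (X - 2) * (of_nat (4 * k + 5) * (X - 1) * (4 - X) - X)) * q k"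
proof -
  have d: "q k + (X - 2) * pderiv (q k) = qc k + (X - 1) * pderiv (qc k) - pderiv (qs k)"
    using arg_cong[OF q_eq_qc_qs[of k], of pderiv]
    by (simp only: pderiv_mult pderiv_diff pderiv_X pderiv_numeral pderiv_1) algebra
  define N :: "int poly" where "N = of_nat (4 * k + 5)"
  have N': "of_nat (4 * k + 6) = N + 1" by (simp add: N_def)
  show ?thesis unfolding Kp_def N' N_def[symmetric]
    using d pderiv_qc_qs[of k, folded N_def] q_eq_qc_qs[of k] unfolding poly_eq_X by algebra
qed

section \<open>Special values, degree and leading coefficient of \<open>q k\<close>\<close>

lemma poly_q_0: "poly (q k) 0 = 2 * int k + 3"
  by (induction k rule: q.induct) simp_all

lemma poly_q_4: "poly (q k) 4 = - (2 * int k + 1)"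
  by (induction k rule: q.induct) simp_all

lemma poly_pderiv_q_step: "poly (pderiv (q (Suc (Suc k)))) x = (2 * x - 4) * poly (q (Suc k)) x
    + (x\<^sup>2 - 4 * x + 2) * poly (pderiv (q (Suc k))) x - poly (pderiv (q k)) x"
  unfolding q.simps(3) pderiv_diff pderiv_mult
  by (simp add: pderiv_pCons power2_eq_square) (simp add: algebra_simps)

lemma pderiv_q_2: "poly (pderiv (q k)) 2 = (- 1) ^ Suc k * (int k + 1)"
proof (induction k rule: q.induct)
  case (3 k)
  then show ?case unfolding poly_pderiv_q_step by (simp add: algebra_simps)
qed (simp_all add: pderiv_pCons)

text \<open>The factor 6 keeps the closed form integral. Written this way, only 3 remains modulo a
  divisor of 2k + 3, so 0 will be a simple root of \<open>q k\<close> modulo suitable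
  primes.\<close>

lemma pderiv_q_0: "6 * poly (pderiv (q k)) 0 = 3 - (2 * int k + 3) * (4 * int k ^ 2 + 12 * int k + 11)"
proof (induction k rule: q.induct)
  case (3 k)
  then show ?case unfolding poly_pderiv_q_step by (simp add: poly_q_0 algebra_simps power2_eq_square)
qed (simp_all add: pderiv_mult pderiv_diff pderiv_pCons)

lemma degree_lead_coeff_q: "degree (q k) = 2 * k + 2 \<and> lead_coeff (q k) = 1"
proof (induction k rule: q.induct)
  case (3 k)
  let ?a = "[:2, -4, 1:] * q (Suc k)"
  have nz: "q (Suc k) \<noteq> 0" using 3 by auto
  have a: "degree ?a = 2 * k + 6"
    using 3 nz by (simp add: degree_mult_eq del: mult_pCons_left)
  have l: "lead_coeff ?a = 1" unfolding lead_coeff_mult 3(1)[THEN conjunct2] by simp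
  have "degree (?a + - q k) = degree ?a"
    using 3 a by (intro degree_add_eq_left) simp
  moreover have "coeff (q k) (2 * k + 6) = 0"
    using 3 by (intro coeff_eq_0) simp
  ultimately show ?case using a l by (simp del: mult_pCons_left)
qed (simp_all add: degree_mult_eq)

lemmas degree_q = degree_lead_coeff_q[THEN conjunct1]
lemmas lead_coeff_q = degree_lead_coeff_q[THEN conjunct2]

section \<open>Images of integer polynomials in other rings\<close>

lemma map_poly_hom_mult:
  assumes "f 0 = 0" "\<And>a b. f (a + b) = f a + f b" "\<And>a b. f (a * b) = f a * f b"
  shows "map_poly f (p * r) = map_poly f p * map_poly f r"
proof (rule poly_eqI)
  have "f (sum u A) = (\<Sum>a\<in>A. f (u a))" if "finite A" for u and A :: "nat set"
    using that by (induction A) (simp_all add: assms)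
  then show "coeff (map_poly f (p * r)) n = coeff (map_poly f p * map_poly f r) n" for n
    by (simp add: coeff_map_poly coeff_mult assms)
qed

abbreviation (input) ip :: "int poly \<Rightarrow> 'a :: comm_ring_1 poly" where
  "ip \<equiv> map_poly of_int"

lemma ip_simps [simp]:
  "ip (p + r) = (ip p + ip r :: 'a :: comm_ring_1 poly)"
  "ip (p - r) = (ip p - ip r :: 'a :: comm_ring_1 poly)"
  "ip (- p) = (- ip p :: 'a :: comm_ring_1 poly)"
  "ip (p * r) = (ip p * ip r :: 'a :: comm_ring_1 poly)"
  "ip (p ^ n) = (ip p ^ n :: 'a :: comm_ring_1 poly)"
  "ip (numeral w) = (numeral w :: 'a :: comm_ring_1 poly)"
  "ip 1 = (1 :: 'a :: comm_ring_1 poly)"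
proof -
  show m: "ip (p * r) = (ip p * ip r :: 'a :: comm_ring_1 poly)" for p r
    by (rule map_poly_hom_mult) simp_all
  show "ip 1 = (1 :: 'a :: comm_ring_1 poly)" by (simp add: one_pCons map_poly_pCons)
  then show "ip (p ^ n) = (ip p ^ n :: 'a :: comm_ring_1 poly)" by (induction n) (simp_all add: m)
qed (auto intro!: poly_eqI simp: coeff_map_poly numeral_poly map_poly_pCons)

lemma ip_pCons [simp]: "ip (pCons a p) = (pCons (of_int a) (ip p) :: 'a :: comm_ring_1 poly)"
  by (simp add: map_poly_pCons)

lemma poly_ip_of_int [simp]: "poly (ip p) (of_int x :: 'a :: comm_ring_1) = of_int (poly p x)"
  by (induction p) simp_all

lemma degree_ip [simp]: "degree (ip p :: 'a :: {comm_ring_1, ring_char_0} poly) = degree p"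
  by (rule degree_map_poly) simp

lemma lead_coeff_ip: "lead_coeff (ip p :: 'a :: {comm_ring_1, ring_char_0} poly) = of_int (lead_coeff p)"
  by (simp add: coeff_map_poly)

lemma ip_eq_0_iff [simp]: "ip p = (0 :: 'a :: {comm_ring_1, ring_char_0} poly) \<longleftrightarrow> p = 0"
  by (simp add: map_poly_eq_0_iff)

lemma ip_eq_iff [simp]: "ip p = (ip r :: 'a :: {comm_ring_1, ring_char_0} poly) \<longleftrightarrow> p = r"
  by (metis ip_eq_0_iff ip_simps(2) right_minus_eq)

text \<open>The factors cos(t) and sin(t) avoid division. The base case expands the angle 5t as 4t +
  t, and the induction adds 4t.\<close>

lemma qc_qs_trig:
  fixes t :: real
  shows "cos t * poly (ip (qc k)) (4 * (cos t)\<^sup>2) = cos ((4 * real k + 5) * t)"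
    and "sin t * poly (ip (qs k)) (4 * (cos t)\<^sup>2) = sin ((4 * real k + 5) * t)"
proof (induction k)
  case 0
  have c2: "cos (2 * t) = 2 * (cos t)\<^sup>2 - 1" by (rule cos_double_cos)
  have s2: "sin (2 * t) = 2 * sin t * cos t" by (rule sin_double)
  have c4: "cos (4 * t) = 2 * (cos (2 * t))\<^sup>2 - 1" using cos_double_cos[of "2 * t"] by simp
  have s4: "sin (4 * t) = 2 * sin (2 * t) * cos (2 * t)" using sin_double[of "2 * t"] by simp
  have sc: "(sin t)\<^sup>2 = 1 - (cos t)\<^sup>2" by (rule sin_squared_eq)
  have "cos (5 * t) = cos (4 * t) * cos t - sin (4 * t) * sin t" using cos_add[of "4 * t" t] by simp
  also have "\<dots> = (2 * (2 * (cos t)\<^sup>2 - 1)\<^sup>2 - 1) * cos t - 4 * cos t * (2 * (cos t)\<^sup>2 - 1) * (sin t)\<^sup>2"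
    unfolding c4 s4 c2 s2 by algebra
  finally have c5: "cos (5 * t) = (2 * (2 * (cos t)\<^sup>2 - 1)\<^sup>2 - 1) * cos t - 4 * cos t * (2 * (cos t)\<^sup>2 - 1) * (1 - (cos t)\<^sup>2)"
    unfolding sc .
  have "sin (5 * t) = sin (4 * t) * cos t + cos (4 * t) * sin t" using sin_add[of "4 * t" t] by simp
  also have "\<dots> = sin t * ((2 * (2 * (cos t)\<^sup>2 - 1)\<^sup>2 - 1) + 4 * (cos t)\<^sup>2 * (2 * (cos t)\<^sup>2 - 1))"
    unfolding c4 s4 c2 s2 by algebra
  finally have s5: "sin (5 * t) = sin t * ((2 * (2 * (cos t)\<^sup>2 - 1)\<^sup>2 - 1) + 4 * (cos t)\<^sup>2 * (2 * (cos t)\<^sup>2 - 1))" .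
  {
    case 1
    show ?case by (simp add: c5) algebra
  next
    case 2
    show ?case by (simp add: s5) algebra
  }
next
  case (Suc k)
  let ?x = "4 * (cos t)\<^sup>2" and ?a = "(4 * real k + 5) * t"
  let ?g = "\<lambda>k. poly (ip (qc k)) ?x" and ?h = "\<lambda>k. poly (ip (qs k)) ?x"
  have G: "2 * ?g (Suc k) = (?x\<^sup>2 - 4 * ?x + 2) * ?g k - (4 - ?x) * (?x - 2) * ?h k"
    using arg_cong[OF qc_qs_step(1)[of k], of "\<lambda>p. poly (ip p) ?x"] by simp
  have H: "2 * ?h (Suc k) = (?x\<^sup>2 - 4 * ?x + 2) * ?h k + ?x * (?x - 2) * ?g k"
    using arg_cong[OF qc_qs_step(2)[of k], of "\<lambda>p. poly (ip p) ?x"] by simp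
  have c2: "cos (2 * t) = 2 * (cos t)\<^sup>2 - 1" by (rule cos_double_cos)
  have s2: "sin (2 * t) = 2 * sin t * cos t" by (rule sin_double)
  have c4: "cos (4 * t) = 2 * (cos (2 * t))\<^sup>2 - 1" using cos_double_cos[of "2 * t"] by simp
  have s4: "sin (4 * t) = 2 * sin (2 * t) * cos (2 * t)" using sin_double[of "2 * t"] by simp
  have sc: "(sin t)\<^sup>2 = 1 - (cos t)\<^sup>2" by (rule sin_squared_eq)
  have arg: "(4 * real (Suc k) + 5) * t = ?a + 4 * t" by (simp add: algebra_simps)
  {
    case 1
    have "2 * (cos t * ?g (Suc k)) = 2 * (cos (4 * t) * (cos t * ?g k) - sin (4 * t) * (sin t * ?h k))"
      using G sc unfolding c4 s4 c2 s2 by algebra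
    then show ?case unfolding Suc arg cos_add by (simp add: mult.commute)
  next
    case 2
    have "2 * (sin t * ?h (Suc k)) = 2 * (cos (4 * t) * (sin t * ?h k) + sin (4 * t) * (cos t * ?g k))"
      using H sc unfolding c4 s4 c2 s2 by algebra
    then show ?case unfolding Suc arg sin_add by (simp add: mult.commute)
  }
qed

subsection \<open>Location of the roots\<close>

text \<open>The nodes are the points where \<open>cos (N t) = 0\<close>; there \<open>(x - 2) q k = - qs k\<close> has alternating sign.\<close>

definition node_angle :: "nat \<Rightarrow> nat \<Rightarrow> real" where
  "node_angle k j = (2 * real j + 1) * pi / (2 * (4 * real k + 5))"

definition node :: "nat \<Rightarrow> nat \<Rightarrow> real" where
  "node k j = 4 * (cos (node_angle k j))\<^sup>2"

lemma node_angle_bounds: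
  assumes "j \<le> 2 * k + 1"
  shows "0 < node_angle k j" "node_angle k j < pi / 2"
proof -
  show "0 < node_angle k j" by (simp add: node_angle_def)
  have "(2 * real j + 1) * pi < (4 * real k + 5) * pi" using assms by simp
  then show "node_angle k j < pi / 2" by (simp add: node_angle_def field_simps)
qed

lemma node_angle_last: "node_angle k (2 * k + 2) = pi / 2"
  by (simp add: node_angle_def field_simps)

lemma node_last: "node k (2 * k + 2) = 0"
  unfolding node_def node_angle_last by simp

lemma node_strict_antimono:
  assumes "i < j" "j \<le> 2 * k + 2"
  shows "node k j < node k i"
proof -
  have i: "i \<le> 2 * k + 1" using assms by simp
  have lt: "node_angle k i < node_angle k j" using assms by (simp add: node_angle_def divide_strict_right_mono)
  have "node_angle k j \<le> pi / 2"
  proof (cases "j = 2 * k + 2")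
    case True
    show ?thesis unfolding True node_angle_last by simp
  next
    case False
    then show ?thesis using node_angle_bounds[of j k] assms by simp
  qed
  then have "0 \<le> cos (node_angle k j)" "cos (node_angle k j) < cos (node_angle k i)"
    using lt node_angle_bounds(1)[OF i]
    by (auto intro!: cos_ge_zero cos_monotone_0_pi)
  then show ?thesis by (simp add: node_def power_strict_mono)
qed

lemma node_le_4: "node k j \<le> 4"
  using abs_cos_le_one[of "node_angle k j"] by (simp add: node_def abs_square_le_1)

lemma q_at_node:
  assumes "j \<le> 2 * k + 1"
  shows "(node k j - 2) * poly (ip (q k)) (node k j) * sin (node_angle k j) = - ((- 1) ^ j)"
proof -
  let ?t = "node_angle k j" and ?x = "node k j"
  have t: "(4 * real k + 5) * ?t = pi / 2 + real j * pi"
    by (simp add: node_angle_def field_simps)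
  have "cos ((4 * real k + 5) * ?t) = 0" "sin ((4 * real k + 5) * ?t) = (- 1) ^ j"
    unfolding t cos_add sin_add by (simp_all add: cos_npi sin_npi)
  then have c: "cos ?t * poly (ip (qc k)) ?x = 0" and s: "sin ?t * poly (ip (qs k)) ?x = (- 1) ^ j"
    using qc_qs_trig[of ?t k] by (simp_all add: node_def)
  have "cos ?t > 0" using node_angle_bounds[OF assms] by (intro cos_gt_zero) auto
  with c have "poly (ip (qc k)) ?x = 0" by simp
  moreover have "(?x - 2) * poly (ip (q k)) ?x = (?x - 1) * poly (ip (qc k)) ?x - poly (ip (qs k)) ?x"
    using arg_cong[OF q_eq_qc_qs[of k], of "\<lambda>p. poly (ip p) ?x"] by simp
  ultimately have "(?x - 2) * poly (ip (q k)) ?x = - poly (ip (qs k)) ?x" by simp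
  then have "(?x - 2) * poly (ip (q k)) ?x * sin ?t = - (sin ?t * poly (ip (qs k)) ?x)" by simp
  then show ?thesis unfolding s .
qed

text \<open>The factor x - 2 = 2 cos(2t) in \<open>q_at_node\<close> changes sign where the angle
  passes pi/4, which happens between nodes \<open>k\<close> and \<open>k + 1\<close>. The last node
  is x = 0, where the value 2k + 3 is used instead.\<close>

lemma q_sign_at_node:
  assumes "j \<le> 2 * k + 2"
  shows "(if j \<le> k then - 1 else 1) * (- 1) ^ j * poly (ip (q k)) (node k j) > 0"
proof (cases "j = 2 * k + 2")
  case True
  have "poly (ip (q k)) (of_int 0) = (of_int (poly (q k) 0) :: real)" by (rule poly_ip_of_int)
  then show ?thesis unfolding True node_last by (simp add: poly_q_0)
next
  case False
  then have j: "j \<le> 2 * k + 1" using assms by simp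
  let ?t = "node_angle k j"
  have x: "node k j - 2 = 2 * cos (2 * ?t)" by (simp add: node_def cos_double_cos)
  have sg: "(if j \<le> k then 1 else - 1) * (node k j - 2) > 0"
  proof (cases "j \<le> k")
    case True
    then have "(2 * real j + 1) * 2 * pi < (4 * real k + 5) * pi" by (intro mult_strict_right_mono) auto
    then have "2 * ?t < pi / 2" by (simp add: node_angle_def field_simps)
    moreover have "- (pi / 2) < 2 * ?t" using node_angle_bounds[OF j] by simp
    ultimately have "cos (2 * ?t) > 0" by (intro cos_gt_zero_pi) auto
    then show ?thesis using True x by simp
  next
    case False
    then have "(4 * real k + 5) * pi < (2 * real j + 1) * 2 * pi" by (intro mult_strict_right_mono) auto
    then have "pi / 2 < 2 * ?t" by (simp add: node_angle_def field_simps)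
    moreover have "2 * ?t < pi" using node_angle_bounds[OF j] by simp
    ultimately have "cos (2 * ?t) < 0" using cos_monotone_0_pi[of "pi / 2" "2 * ?t"] by simp
    then show ?thesis using False x by simp
  qed
  have st: "sin ?t > 0" using node_angle_bounds[OF j] by (intro sin_gt_zero) auto
  have "((if j \<le> k then 1 else - 1) * (node k j - 2)) * sin ?t *
      ((if j \<le> k then - 1 else 1) * (- 1) ^ j * poly (ip (q k)) (node k j))
      = - ((- 1) ^ j * ((node k j - 2) * poly (ip (q k)) (node k j) * sin ?t))"
    by (simp add: algebra_simps)
  also have "\<dots> = 1" unfolding q_at_node[OF j] by simp
  finally show ?thesis using sg st
    by (smt (verit) mult_pos_pos zero_less_mult_iff)
qed

text \<open>Adjacent nodes give opposite signs of \<open>q k\<close>, except for \<open>k\<close>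
  and \<open>k + 1\<close>, where the sign change of x - 2 cancels the alternation. This still
  leaves 2k + 1 intervals.\<close>

lemma q_root_between_nodes:
  assumes "j \<le> 2 * k + 1" "j \<noteq> k"
  obtains x where "node k (Suc j) < x" "x < node k j" "poly (ip (q k)) x = 0"
proof -
  have "poly (ip (q k)) (node k (Suc j)) * poly (ip (q k)) (node k j) < 0"
    using q_sign_at_node[of j k] q_sign_at_node[of "Suc j" k] assms
    by (cases "even j") (auto simp: mult_less_0_iff split: if_splits)
  then show ?thesis using poly_IVT[of "node k (Suc j)" "node k j"] node_strict_antimono[of j "Suc j" k] assms that
    by (force simp: mult.commute)
qed

text \<open>\<open>q k\<close> is negative at 4 and monic.\<close>

lemma q_root_gt_4:
  obtains x :: real where "4 < x" "poly (ip (q k)) x = 0"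
proof -
  have 4: "poly (ip (q k)) (4 :: real) < 0"
    using poly_ip_of_int[of "q k" 4, where 'a = real] by (simp add: poly_q_4)
  have "lead_coeff (ip (q k) :: real poly) > 0" unfolding lead_coeff_ip lead_coeff_q by simp
  then obtain n where n: "\<forall>x\<ge>n. lead_coeff (ip (q k)) \<le> poly (ip (q k) :: real poly) x"
    using poly_pinfty_gt_lc[of "ip (q k) :: real poly"] by auto
  define b where "b = max n 5"
  have "poly (ip (q k)) b > 0" using n \<open>lead_coeff (ip (q k) :: real poly) > 0\<close>
    by (smt (verit) b_def max.cobounded1)
  moreover have "4 < b" by (simp add: b_def)
  ultimately show ?thesis using poly_IVT_pos[of 4 b "ip (q k)"] 4 that by blast
qed

text \<open>The 2k + 1 roots between nodes and one root beyond 4 already exhaust the degree 2k + 2,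
  so there are no others and the one beyond 4 is the maximum.\<close>

lemma q_real_roots:
  fixes k :: nat
  defines "R \<equiv> {x :: real. poly (ip (q k)) x = 0}"
  shows "finite R" "card R = 2 * k + 2" "d k \<in> R" "d k > 4" "\<And>x. x \<in> R \<Longrightarrow> x \<noteq> d k \<Longrightarrow> 0 < x \<and> x < 4"
proof -
  have q0: "ip (q k) \<noteq> (0 :: real poly)" using lead_coeff_q[of k] by auto
  then show fin: "finite R" unfolding R_def by (rule poly_roots_finite)
  have le: "card R \<le> 2 * k + 2" 
    unfolding R_def using card_poly_roots_bound[OF q0] by (simp add: degree_q)
  define J where "J = {..2 * k + 1} - {k}"
  have "\<forall>j\<in>J. \<exists>x. node k (Suc j) < x \<and> x < node k j \<and> poly (ip (q k)) x = 0"
    unfolding J_def using q_root_between_nodes by (metis DiffE atMost_iff singletonI)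
  then obtain r where r: "\<And>j. j \<in> J \<Longrightarrow> node k (Suc j) < r j \<and> r j < node k j \<and> poly (ip (q k)) (r j) = 0"
    by metis
  have lt: "r j < r i" if "i \<in> J" "j \<in> J" "i < j" for i j
  proof -
    have "node k j \<le> node k (Suc i)"
      using node_strict_antimono[of "Suc i" j k] that by (cases "Suc i = j") (auto simp: J_def)
    then show ?thesis using r[OF that(1)] r[OF that(2)] by linarith
  qed
  then have inj: "inj_on r J" by (intro inj_onI) (metis less_irrefl linorder_neqE_nat)
  have cJ: "card J = 2 * k + 1" by (simp add: J_def)
  have small: "0 < r j \<and> r j < 4" if "j \<in> J" for j
  proof -
    have "node k (Suc j) \<ge> 0" by (simp add: node_def)
    then show ?thesis using r[OF that] node_le_4[of k j] by linarith
  qed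
  obtain y :: real where y: "4 < y" "poly (ip (q k)) y = 0" by (rule q_root_gt_4[of k])
  have sub: "insert y (r ` J) \<subseteq> R" using r y by (auto simp: R_def)
  have "card (insert y (r ` J)) = 2 * k + 2"
  proof (subst card_insert_disjoint)
    show "finite (r ` J)" by (simp add: J_def)
    show "y \<notin> r ` J" using small y(1) by fastforce
    show "Suc (card (r ` J)) = 2 * k + 2" using inj cJ by (simp add: card_image)
  qed
  with le sub fin have eq: "R = insert y (r ` J)" and c: "card R = 2 * k + 2"
    using card_seteq[OF fin sub] by auto
  show "card R = 2 * k + 2" by fact
  have "d k = Max R" by (simp add: d_def R_def)
  also have "\<dots> = y" unfolding eq using fin eq small y by (intro Max_eqI) (auto intro: less_imp_le less_trans)
  finally have "d k = y" .
  then show "d k \<in> R" "d k > 4" using y by (auto simp: R_def)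
  show "0 < x \<and> x < 4" if "x \<in> R" "x \<noteq> d k" for x
    using that small unfolding eq \<open>d k = y\<close> by auto
qed

lemma q_complex_roots:
  "finite {z :: complex. poly (ip (q k)) z = 0}"
  "card {z :: complex. poly (ip (q k)) z = 0} = 2 * k + 2"
  "poly (ip (q k)) (complex_of_real (d k)) = 0"
  "poly (ip (q k)) z = 0 \<Longrightarrow> z \<noteq> complex_of_real (d k) \<Longrightarrow> \<exists>x. z = complex_of_real x \<and> 0 < x \<and> x < 4"
proof -
  let ?R = "{x :: real. poly (ip (q k)) x = 0}" and ?Z = "{z :: complex. poly (ip (q k)) z = 0}"
  have ev: "poly (ip p) (complex_of_real x) = complex_of_real (poly (ip p) x)" for p x
    by (induction p) simp_all
  have q0: "ip (q k) \<noteq> (0 :: complex poly)" using lead_coeff_q[of k] by auto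
  then show fin: "finite ?Z" by (rule poly_roots_finite)
  have le: "card ?Z \<le> 2 * k + 2" using card_poly_roots_bound[OF q0] by (simp add: degree_q)
  have sub: "complex_of_real ` ?R \<subseteq> ?Z" by (auto simp: ev)
  have c: "card (complex_of_real ` ?R) = 2 * k + 2"
    using q_real_roots(2)[of k] by (subst card_image) (auto simp: inj_on_def)
  have eq: "complex_of_real ` ?R = ?Z" using card_seteq[OF fin sub] c le by simp
  then show "card ?Z = 2 * k + 2" using c by simp
  show "poly (ip (q k)) (complex_of_real (d k)) = 0" using q_real_roots(3)[of k] by (simp add: ev)
  show "\<exists>x. z = complex_of_real x \<and> 0 < x \<and> x < 4" if "poly (ip (q k)) z = 0" "z \<noteq> complex_of_real (d k)"
    using that eq q_real_roots(5)[of _ k] by blast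
qed

subsection \<open>The cofactor of the minimal polynomial\<close>

text \<open>Pseudo-division scales \<open>F\<close> by a power of the leading coefficient of
  \<open>P\<close>, which is 1 here.\<close>

lemma monic_division:
  fixes F P :: "int poly"
  assumes "lead_coeff P = 1"
  obtains Q R where "F = P * Q + R" "R = 0 \<or> degree R < degree P"
proof -
  obtain Q R where QR: "pseudo_divmod F P = (Q, R)" by fastforce
  have "P \<noteq> 0" using assms by auto
  from pseudo_divmod[OF this QR] assms show ?thesis by (intro that[of Q R]) auto
qed

lemma monic_complex_factorization:
  fixes C :: "int poly"
  assumes "lead_coeff C = 1"
  obtains Z :: "complex multiset" where "ip C = (\<Prod>z\<in>#Z. [:- z, 1:])" "size Z = degree C"
proof -
  have "lead_coeff (ip C :: complex poly) = 1" unfolding lead_coeff_ip assms by simp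
  moreover have "ip C \<noteq> (0 :: complex poly)" using assms by auto
  ultimately show ?thesis using alg_closed_imp_factorization[of "ip C :: complex poly"] that
    by (metis degree_ip smult_1_left)
qed

text \<open>Only the elementary symmetric functions of the roots matter later; they are read off the
  coefficients.\<close>

lemma Dp_complex_roots:
  obtains a b c :: complex where "a + b + c = 6" "a * b + b * c + c * a = 8" "a * b * c = 4"
    "\<And>x. poly (ip Dp) x = (x - a) * (x - b) * (x - c)"
proof -
  have l: "lead_coeff Dp = 1" "degree Dp = 3" by (simp_all add: Dp_def)
  obtain Z :: "complex multiset" where Z: "ip Dp = (\<Prod>z\<in>#Z. [:- z, 1:])" "size Z = 3"
    using monic_complex_factorization[OF l(1)] l(2) by metis
  obtain zs where zs: "Z = mset zs" by (metis ex_mset)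
  with Z(2) have "length zs = Suc (Suc (Suc 0))" by simp
  then obtain a b c where "zs = [a, b, c]" by (auto simp: length_Suc_conv)
  with zs have "Z = {#a, b, c#}" by simp
  with Z(1) have eq: "ip Dp = [:- a, 1:] * [:- b, 1:] * [:- c, 1:]" by (simp add: algebra_simps)
  have co: "coeff (ip Dp) i = coeff ([:- a, 1:] * [:- b, 1:] * [:- c, 1:]) i" for i by (simp only: eq)
  show ?thesis
  proof (rule that)
    show "a + b + c = 6" using co[of 2] by (simp add: Dp_def coeff_pCons numeral_2_eq_2 algebra_simps)
    show "a * b + b * c + c * a = 8" using co[of 1] by (simp add: Dp_def coeff_pCons algebra_simps)
    show "a * b * c = 4" using co[of 0] by (simp add: Dp_def coeff_pCons algebra_simps)
    show "poly (ip Dp) x = (x - a) * (x - b) * (x - c)" for x unfolding eq by (simp add: algebra_simps)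
  qed
qed

text \<open>The product is the resultant of \<open>Dp\<close> and \<open>F\<close>. After reducing
  \<open>F\<close> to a quadratic modulo \<open>Dp\<close>, it is a symmetric function of the roots.
  As 6, 8 and 4 are even, it is congruent modulo 2 to the cube of the constant term.\<close>

lemma cubic_norm_integer:
  fixes a b c :: complex and F :: "int poly"
  assumes "a + b + c = 6" "a * b + b * c + c * a = 8" "a * b * c = 4"
    "\<And>x. poly (ip Dp) x = (x - a) * (x - b) * (x - c)"
  obtains n where "poly (ip F) a * poly (ip F) b * poly (ip F) c = of_int n" "odd n \<longleftrightarrow> odd (poly F 0)"
proof -
  obtain Q R where QR: "F = Dp * Q + R" "R = 0 \<or> degree R < degree Dp"
    by (rule monic_division[of Dp F]) (simp add: Dp_def)
  have "degree R \<le> 2" using QR(2) by (auto simp: Dp_def)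
  then obtain u v w where R: "R = [:u, v, w:]"
  proof -
    have "R = [:coeff R 0, coeff R 1, coeff R 2:]"
    proof (rule poly_eqI)
      fix n
      show "coeff R n = coeff [:coeff R 0, coeff R 1, coeff R 2:] n"
      proof (cases "n \<le> 2")
        case True
        then have "n = 0 \<or> n = 1 \<or> n = 2" by linarith
        then show ?thesis by (auto simp: numeral_2_eq_2)
      next
        case False
        then show ?thesis using \<open>degree R \<le> 2\<close> by (simp add: coeff_eq_0)
      qed
    qed
    then show ?thesis by (rule that)
  qed
  let ?f = "\<lambda>x. complex_of_int u + of_int v * x + of_int w * x\<^sup>2"
  have ev: "poly (ip F) x = ?f x" if "poly (ip Dp) x = (0 :: complex)" for x
    using that unfolding QR(1) by (simp add: R algebra_simps power2_eq_square)
  have F0: "poly F 0 = - 4 * poly Q 0 + u" unfolding QR(1) by (simp add: R Dp_def)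
  \<comment> \<open>Half of the expanded product without its term \<open>u ^ 3\<close>, after
    inserting the symmetric functions 6, 8 and 4.\<close>
  define m where "m = 3 * u^2 * v + 10 * u^2 * w + 4 * u * v^2 + 18 * u * v * w + 8 * u * w^2 + 2 * v^3
    + 12 * v^2 * w + 16 * v * w^2 + 8 * w^3"
  have "poly (ip F) a * poly (ip F) b * poly (ip F) c = ?f a * ?f b * ?f c"
    by (simp add: ev assms(4))
  also have "\<dots> = of_int u ^ 3 + of_int u ^ 2 * of_int v * (a + b + c) + of_int u ^ 2 * of_int w * ((a + b + c)\<^sup>2 - 2 * (a * b + b * c + c * a))
      + of_int u * of_int v ^ 2 * (a * b + b * c + c * a)
      + of_int u * of_int v * of_int w * ((a + b + c) * (a * b + b * c + c * a) - 3 * (a * b * c))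
      + of_int u * of_int w ^ 2 * ((a * b + b * c + c * a)\<^sup>2 - 2 * (a + b + c) * (a * b * c))
      + of_int v ^ 3 * (a * b * c) + of_int v ^ 2 * of_int w * (a + b + c) * (a * b * c)
      + of_int v * of_int w ^ 2 * (a * b + b * c + c * a) * (a * b * c) + of_int w ^ 3 * (a * b * c)\<^sup>2"
    by algebra
  also have "\<dots> = of_int (u ^ 3 + 2 * m)"
    unfolding assms(1-3) m_def by simp
  finally show ?thesis by (rule that) (simp add: F0)
qed

lemma prod_mset_less:
  fixes f g :: "'a \<Rightarrow> real"
  assumes "\<And>z. z \<in># Z \<Longrightarrow> 0 < f z \<and> f z \<le> g z" "w \<in># Z" "f w < g w"
  shows "(\<Prod>z\<in>#Z. f z) < (\<Prod>z\<in>#Z. g z)"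
proof -
  have le: "0 < (\<Prod>z\<in>#Y. f z) \<and> (\<Prod>z\<in>#Y. f z) \<le> (\<Prod>z\<in>#Y. g z)"
    if "\<And>z. z \<in># Y \<Longrightarrow> 0 < f z \<and> f z \<le> g z" for Y
    using that
  proof (induction Y)
    case (add x Y)
    then have "0 < f x" "f x \<le> g x" "0 < (\<Prod>z\<in>#Y. f z)" "(\<Prod>z\<in>#Y. f z) \<le> (\<Prod>z\<in>#Y. g z)" by auto
    then show ?case by (auto intro: mult_mono)
  qed simp
  obtain Y where Z: "Z = add_mset w Y" using assms(2) by (metis mset_add)
  have "0 < (\<Prod>z\<in>#Y. f z)" "(\<Prod>z\<in>#Y. f z) \<le> (\<Prod>z\<in>#Y. g z)" using le[of Y] assms(1) Z by auto
  moreover have "0 < f w" using assms(1,2) by blast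
  ultimately have "f w * (\<Prod>z\<in>#Y. f z) < g w * (\<Prod>z\<in>#Y. g z)"
    using assms(3) by (intro mult_less_le_imp_less) auto
  then show ?thesis unfolding Z by simp
qed

lemma cofactor_roots_eq_1:
  fixes P C :: "int poly" and z :: complex
  assumes q: "q k = P * C" and C: "lead_coeff C = 1" and P: "poly (ip P) (complex_of_real (d k)) = 0"
    and z: "poly (ip C) z = 0"
  shows "z = 1"
proof -
  let ?A = "{z :: complex. poly (ip P) z = 0}" and ?B = "{z :: complex. poly (ip C) z = 0}"
  have nz: "ip P \<noteq> (0 :: complex poly)" "ip C \<noteq> (0 :: complex poly)"
    using q lead_coeff_q[of k] by auto
  have deg: "degree P + degree C = 2 * k + 2"
    using nz degree_q[of k] unfolding q by (simp add: degree_mult_eq)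
  have un: "{z :: complex. poly (ip (q k)) z = 0} = ?A \<union> ?B" unfolding q by auto
  have fin: "finite ?A" "finite ?B" using nz by (auto intro: poly_roots_finite)
  have "card ?A \<le> degree P" "card ?B \<le> degree C"
    using card_poly_roots_bound[OF nz(1)] card_poly_roots_bound[OF nz(2)] by simp_all
  \<comment> \<open>\<open>q k\<close> has as many distinct roots as its degree, so \<open>P\<close>
    and \<open>C\<close> share none; hence \<open>d k\<close> is not a root of
    \<open>C\<close>.\<close>
  moreover have "card ?A + card ?B = card (?A \<union> ?B) + card (?A \<inter> ?B)" by (rule card_Un_Int[OF fin])
  moreover have "card (?A \<union> ?B) = 2 * k + 2" using q_complex_roots(2)[of k] unfolding un .
  ultimately have "card (?A \<inter> ?B) = 0" using deg by linarith
  then have disj: "?A \<inter> ?B = {}" using fin by simp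
  have real: "\<exists>x. w = complex_of_real x \<and> 0 < x \<and> x < 4" if "poly (ip C) w = 0" for w :: complex
  proof (rule q_complex_roots(4)[of k])
    show "poly (ip (q k)) w = 0" using that unfolding q by simp
    show "w \<noteq> complex_of_real (d k)" using disj P that by auto
  qed
  obtain Z :: "complex multiset" where Z: "ip C = (\<Prod>z\<in>#Z. [:- z, 1:])" using monic_complex_factorization[OF C] by metis
  have evC: "poly (ip C) x = (\<Prod>z\<in>#Z. x - z)" for x unfolding Z poly_prod_mset by simp
  have rootZ: "w \<in># Z \<longleftrightarrow> poly (ip C) w = 0" for w
    unfolding evC by (auto simp: prod_mset_zero_iff)
  obtain a b c :: complex where abc: "a + b + c = 6" "a * b + b * c + c * a = 8" "a * b * c = 4"
    "\<And>x. poly (ip Dp) x = (x - a) * (x - b) * (x - c)" by (rule Dp_complex_roots) blast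
  \<comment> \<open>The cofactor of \<open>C\<close> in \<open>4 + Dp * (qc k)\<^sup>2\<close>; thus
    \<open>C * B\<close> takes the value 4 at every root of \<open>Dp\<close>.\<close>
  define B where "B = P * ((4 - X) * (X - 2) * ((X - 2) * q k - 2 * (X - 1) * qc k))"
  have CB: "C * B = 4 + Dp * (qc k)\<^sup>2"
    unfolding four_plus_Dp_qc B_def q by (simp only: mult_ac)
  obtain n where n: "poly (ip C) a * poly (ip C) b * poly (ip C) c = of_int n" "odd n \<longleftrightarrow> odd (poly C 0)"
    using cubic_norm_integer[OF abc] by blast
  obtain m where m: "poly (ip B) a * poly (ip B) b * poly (ip B) c = of_int m"
    using cubic_norm_integer[OF abc] by blast
  have "poly (ip C) x * poly (ip B) x = 4" if "poly (ip Dp) x = (0 :: complex)" for x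
    using arg_cong[OF CB, of "\<lambda>p. poly (ip p) x"] that by simp
  then have "poly (ip C) a * poly (ip B) a = 4" "poly (ip C) b * poly (ip B) b = 4" "poly (ip C) c * poly (ip B) c = 4"
    by (simp_all add: abc(4))
  moreover have "(c1 * c2 * c3) * (b1 * b2 * b3) = (c1 * b1) * (c2 * b2) * (c3 * b3)" for c1 c2 c3 b1 b2 b3 :: complex
    by (simp only: mult_ac)
  ultimately have "(poly (ip C) a * poly (ip C) b * poly (ip C) c) * (poly (ip B) a * poly (ip B) b * poly (ip B) c) = 4 * 4 * 4"
    by (simp only:)
  then have "complex_of_int (n * m) = of_int 64" unfolding n m by simp
  then have nm: "n * m = 2 ^ 6" by (simp only: of_int_eq_iff) simp
  \<comment> \<open>\<open>C\<close> has odd constant term since it divides 2k + 3; so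
    \<open>n\<close> is an odd divisor of 64.\<close>
  have PC0: "poly P 0 * poly C 0 = 2 * int k + 3" using poly_q_0[of k] unfolding q by simp
  then have "odd (poly C 0)" by (metis even_mult_iff even_plus_one_iff numeral_Bit1 add.assoc even_add dvd_triv_left odd_numeral)
  then have "coprime n 2" using n by simp
  then have "coprime n (2 ^ 6)" by (rule coprime_power_right_iff[THEN iffD2, OF disjI1])
  then have "is_unit n" using nm coprime_common_divisor[of n "2 ^ 6" n] by (metis dvd_refl dvd_triv_left)
  then have "\<bar>n\<bar> = 1" by simp
  then have "norm (poly (ip C) a * poly (ip C) b * poly (ip C) c) = 1" unfolding n by simp
  \<comment> \<open>Symmetry of the resultant up to sign: evaluating \<open>C\<close> at the roots
    of \<open>Dp\<close> is traded for evaluating \<open>Dp\<close> at the roots of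
    \<open>C\<close>.\<close>
  moreover have "poly (ip C) a * poly (ip C) b * poly (ip C) c = (\<Prod>z\<in>#Z. (a - z) * (b - z) * (c - z))"
    unfolding evC by (simp add: prod_mset.distrib)
  moreover have "norm (\<Prod>z\<in>#Y. f z) = (\<Prod>z\<in>#Y. norm (f z))" for f :: "complex \<Rightarrow> complex" and Y
    by (induction Y) (simp_all add: norm_mult)
  moreover have "norm ((a - w) * (b - w) * (c - w)) = norm (poly (ip Dp) w)" for w
    unfolding abc(4) by (simp add: norm_mult norm_minus_commute)
  ultimately have one: "(\<Prod>z\<in>#Z. norm (poly (ip Dp) z)) = 1" by simp
  have "poly C 0 \<noteq> 0" using \<open>odd (poly C 0)\<close> by auto
  then have "1 \<le> norm (of_int (poly C 0) :: complex)" by simp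
  also have "of_int (poly C 0) = (\<Prod>z\<in>#Z. - z)" using evC[of 0] poly_ip_of_int[of C 0, where 'a = complex] by simp
  also have "norm \<dots> = (\<Prod>z\<in>#Z. norm z)" by (induction Z) (simp_all add: norm_mult)
  finally have ge: "1 \<le> (\<Prod>z\<in>#Z. norm z)" .
  have D: "norm (poly (ip Dp) w) = norm w + (Re w - 1)\<^sup>2 * (4 - Re w)" "0 < Re w" "Re w < 4" "Im w = 0" "norm w > 0" if w: "w \<in># Z" for w
  proof -
    obtain x where x: "w = complex_of_real x" "0 < x" "x < 4" using real[OF rootZ[THEN iffD1, OF w]] by auto
    have "poly (ip Dp) w = complex_of_real (- (x + (x - 1)\<^sup>2 * (4 - x)))"
      unfolding x(1) by (simp add: Dp_def algebra_simps power2_eq_square)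
    moreover have "x + (x - 1)\<^sup>2 * (4 - x) > 0" using x by (intro add_pos_nonneg) auto
    ultimately show "norm (poly (ip Dp) w) = norm w + (Re w - 1)\<^sup>2 * (4 - Re w)"
      by (simp only: norm_of_real abs_minus) (use x in simp)
    show "0 < Re w" "Re w < 4" "Im w = 0" "norm w > 0" using x by auto
  qed
  have zZ: "z \<in># Z" using z rootZ by simp
  \<comment> \<open>Each root of \<open>C\<close> has norm at most that of its value under
    \<open>Dp\<close>. One strict inequality would make the product of those values exceed the
    product of the roots, which is at least 1.\<close>
  have "\<not> norm z < norm (poly (ip Dp) z)"
  proof
    assume lt: "norm z < norm (poly (ip Dp) z)"
    have "(\<Prod>z\<in>#Z. norm z) < (\<Prod>z\<in>#Z. norm (poly (ip Dp) z))"
    proof (rule prod_mset_less[where w = z])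
      show "z \<in># Z" by fact
      show "norm z < norm (poly (ip Dp) z)" by fact
      fix w assume w: "w \<in># Z"
      have "0 \<le> (Re w - 1)\<^sup>2 * (4 - Re w)" using D(3)[OF w] by simp
      then show "0 < norm w \<and> norm w \<le> norm (poly (ip Dp) w)" using D(1,5)[OF w] by linarith
    qed
    with one ge show False by simp
  qed
  then have "(Re z - 1)\<^sup>2 * (4 - Re z) \<le> 0" using D[OF zZ] by simp
  then have "Re z = 1" using D(3)[OF zZ] by (simp add: mult_le_0_iff)
  with D(4)[OF zZ] show "z = 1" by (simp add: complex_eq_iff)
qed

lemma cofactor_eq_power:
  fixes P C :: "int poly"
  assumes "q k = P * C" "lead_coeff C = 1" "poly (ip P) (complex_of_real (d k)) = 0"
  shows "C = [:- 1, 1:] ^ degree C"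
proof -
  obtain Z :: "complex multiset" where Z: "ip C = (\<Prod>z\<in>#Z. [:- z, 1:])" "size Z = degree C"
    using monic_complex_factorization[OF assms(2)] by metis
  have "z = 1" if "z \<in># Z" for z
    using cofactor_roots_eq_1[OF assms, of z] that Z by (auto simp: poly_prod_mset prod_mset_zero_iff)
  then have "image_mset (\<lambda>z. [:- z, 1:]) Z = image_mset (\<lambda>z. [:- 1, 1:]) Z"
    by (intro image_mset_cong) simp
  then have "ip C = [:- 1, 1 :: complex:] ^ degree C" using Z by (simp add: image_mset_const_eq)
  also have "\<dots> = ip ([:- 1, 1:] ^ degree C)" by simp
  finally show ?thesis by (simp only: ip_eq_iff)
qed

subsection \<open>Chebyshev polynomials modulo a prime\<close>

lemma poly_diff_dvd: "(a - b :: int) dvd poly f a - poly f b"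
proof (induction f)
  case (pCons c f)
  have "poly (pCons c f) a - poly (pCons c f) b = (a - b) * poly f a + b * (poly f a - poly f b)"
    by (simp add: algebra_simps)
  with pCons show ?case by simp
qed simp

lemma dvd_poly_cong:
  fixes p :: int
  assumes "p dvd a - b" "p dvd poly f a"
  shows "p dvd poly f b"
proof -
  have "p dvd poly f a - poly f b" using assms(1) poly_diff_dvd[of a b f] by (rule dvd_trans)
  from dvd_diff[OF assms(2) this] show ?thesis by simp
qed

text \<open>If \<open>b = u + 1 / u\<close>, these are \<open>u ^ n + 1 / u ^ n\<close> and \<open>(u ^ n - 1 / u ^ n) / (u - 1 / u)\<close>.\<close>

fun chebV :: "int \<Rightarrow> nat \<Rightarrow> int" where
  "chebV b 0 = 2"
| "chebV b (Suc 0) = b"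
| "chebV b (Suc (Suc n)) = b * chebV b (Suc n) - chebV b n"

fun chebU :: "int \<Rightarrow> nat \<Rightarrow> int" where
  "chebU b 0 = 0"
| "chebU b (Suc 0) = 1"
| "chebU b (Suc (Suc n)) = b * chebU b (Suc n) - chebU b n"

lemma cheb_step:
  "2 * chebV b (Suc n) = b * chebV b n + (b\<^sup>2 - 4) * chebU b n"
  "2 * chebU b (Suc n) = b * chebU b n + chebV b n"
proof (induction n rule: q.induct)
  case (3 n)
  {
    case 1
    show ?case using 3 unfolding chebV.simps(3) chebU.simps(3) by algebra
  next
    case 2
    show ?case using 3 unfolding chebV.simps(3) chebU.simps(3) by algebra
  }
qed (simp_all add: power2_eq_square)

lemma cheb_pell: "(chebV b n)\<^sup>2 - (b\<^sup>2 - 4) * (chebU b n)\<^sup>2 = 4"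
proof (induction n)
  case (Suc n)
  have "4 * ((chebV b (Suc n))\<^sup>2 - (b\<^sup>2 - 4) * (chebU b (Suc n))\<^sup>2)
     = (2 * chebV b (Suc n))\<^sup>2 - (b\<^sup>2 - 4) * (2 * chebU b (Suc n))\<^sup>2" by algebra
  also have "\<dots> = 4 * ((chebV b n)\<^sup>2 - (b\<^sup>2 - 4) * (chebU b n)\<^sup>2)" unfolding cheb_step by algebra
  finally show ?case using Suc by simp
qed simp

text \<open>With b = x - 2 = 2 cos(2t) and n = 2k + 3, the Chebyshev values are 2 cos((N+1)t) and
  sin((N+1)t)/sin(2t), and the formula expands cos((N+1)t - t). The index 2k + 3 is the one that can
  be prime later.\<close>

lemma qc_cheb: "2 * poly (qc k) x = chebV (x - 2) (2 * k + 3) + (4 - x) * chebU (x - 2) (2 * k + 3)"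
proof (induction k rule: q.induct)
  case 1
  then show ?case by (simp add: numeral_3_eq_3 algebra_simps)
next
  case 2
  then show ?case by (simp add: numeral_eq_Suc algebra_simps)
next
  case (3 k)
  have r: "chebV b (n + 4) = (b\<^sup>2 - 2) * chebV b (n + 2) - chebV b n"
    "chebU b (n + 4) = (b\<^sup>2 - 2) * chebU b (n + 2) - chebU b n" for b n
    by (simp_all add: numeral_eq_Suc algebra_simps)
  have "2 * Suc (Suc k) + 3 = (2 * k + 3) + 4" "2 * Suc k + 3 = (2 * k + 3) + 2" by simp_all
  then have V: "chebV (x - 2) (2 * Suc (Suc k) + 3) = ((x - 2)\<^sup>2 - 2) * chebV (x - 2) (2 * Suc k + 3) - chebV (x - 2) (2 * k + 3)"
    and U: "chebU (x - 2) (2 * Suc (Suc k) + 3) = ((x - 2)\<^sup>2 - 2) * chebU (x - 2) (2 * Suc k + 3) - chebU (x - 2) (2 * k + 3)"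
    by (simp_all only: r)
  have Q: "poly (qc (Suc (Suc k))) x = ((x - 2)\<^sup>2 - 2) * poly (qc (Suc k)) x - poly (qc k) x"
    by (simp add: algebra_simps power2_eq_square)
  show ?case using 3 unfolding V U Q by algebra
qed

text \<open>Binomial expansion of (u + 1/u)^n, added to its mirror image so that opposite powers
  pair up. The conditional is the absolute value of n - 2i, written in natural numbers.\<close>

lemma chebV_binomial:
  "2 * b ^ n = (\<Sum>i\<le>n. int (n choose i) * chebV b (if 2 * i \<le> n then n - 2 * i else 2 * i - n))"
proof -
  define s where "s = csqrt (of_int (b\<^sup>2 - 4))"
  \<comment> \<open>The two roots of T^2 - bT + 1, hence inverse to each other.\<close>
  define u v where "u = (of_int b + s) / 2" and "v = (of_int b - s) / 2"
  have s2: "s\<^sup>2 = of_int (b\<^sup>2 - 4)" by (simp add: s_def)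
  have uv: "u + v = of_int b" "u * v = 1"
    using s2 by (simp_all add: u_def v_def field_simps power2_eq_square)
  have V: "of_int (chebV b n) = u ^ n + v ^ n" for n
  proof (induction n rule: q.induct)
    case (3 n)
    have "u ^ Suc (Suc n) + v ^ Suc (Suc n) = (u + v) * (u ^ Suc n + v ^ Suc n) - u * v * (u ^ n + v ^ n)"
      by (simp add: algebra_simps)
    then show ?case using 3 uv by simp
  qed (use uv in simp_all)
  have W: "of_int (chebV b (if 2 * i \<le> n then n - 2 * i else 2 * i - n)) = u ^ i * v ^ (n - i) + v ^ i * u ^ (n - i)"
    if "i \<le> n" for i
  proof (cases "2 * i \<le> n")
    case True
    then have "n - i = i + (n - 2 * i)" by simp
    then have "u ^ (n - i) = u ^ i * u ^ (n - 2 * i)" "v ^ (n - i) = v ^ i * v ^ (n - 2 * i)"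
      by (metis power_add)+
    then have "u ^ i * v ^ (n - i) + v ^ i * u ^ (n - i) = (u * v) ^ i * (u ^ (n - 2 * i) + v ^ (n - 2 * i))"
      by (simp add: power_mult_distrib algebra_simps)
    then show ?thesis using True uv V by simp
  next
    case False
    with that have "i = (n - i) + (2 * i - n)" by simp
    then have "u ^ i = u ^ (n - i) * u ^ (2 * i - n)" "v ^ i = v ^ (n - i) * v ^ (2 * i - n)"
      by (metis power_add)+
    then have "u ^ i * v ^ (n - i) + v ^ i * u ^ (n - i) = (u * v) ^ (n - i) * (u ^ (2 * i - n) + v ^ (2 * i - n))"
      by (simp add: power_mult_distrib algebra_simps)
    then show ?thesis using False uv V by simp
  qed
  have "complex_of_int (2 * b ^ n) = (u + v) ^ n + (v + u) ^ n" using uv(1) by (simp add: add.commute)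
  also have "\<dots> = (\<Sum>i\<le>n. of_nat (n choose i) * (u ^ i * v ^ (n - i) + v ^ i * u ^ (n - i)))"
    unfolding binomial_ring by (simp add: sum.distrib algebra_simps)
  also have "\<dots> = (\<Sum>i\<le>n. of_nat (n choose i) * of_int (chebV b (if 2 * i \<le> n then n - 2 * i else 2 * i - n)))"
    by (intro sum.cong refl) (simp only: W atMost_iff)
  finally have "complex_of_int (2 * b ^ n) = of_int (\<Sum>i\<le>n. int (n choose i) * chebV b (if 2 * i \<le> n then n - 2 * i else 2 * i - n))"
    by simp
  then show ?thesis by (simp only: of_int_eq_iff)
qed

section \<open>Binomial and Chebyshev congruences modulo a prime\<close>

lemma prime_dvd_choose:
  assumes "prime p" "0 < i" "i < p"
  shows "p dvd p choose i"
proof -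
  have "p dvd fact i * fact (p - i) * (p choose i)"
    using assms by (simp add: binomial_fact_lemma prime_dvd_fact_iff)
  moreover have "\<not> p dvd fact i" "\<not> p dvd fact (p - i)"
    using assms by (simp_all add: prime_dvd_fact_iff)
  ultimately show ?thesis using assms(1) by (simp add: prime_dvd_mult_iff)
qed

lemma fermat_int:
  assumes "prime p"
  shows "int p dvd b ^ p - b"
proof -
  have p: "p > 0" using assms prime_gt_0_nat by blast
  have step: "int p dvd (b + 1) ^ p - b ^ p - 1" for b
  proof -
    have "{..p} = insert 0 (insert p {0<..<p})" using p by auto
    then have "(b + 1) ^ p - b ^ p - 1 = (\<Sum>i\<in>{0<..<p}. int (p choose i) * b ^ i)"
      unfolding binomial_ring using p by simp
    moreover have "int p dvd (\<Sum>i\<in>{0<..<p}. int (p choose i) * b ^ i)"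
      using assms by (intro dvd_sum dvd_mult2) (auto intro: prime_dvd_choose)
    ultimately show ?thesis by simp
  qed
  show ?thesis
  proof (induction b rule: int_induct[where k = 0])
    case base
    show ?case using p by (simp add: zero_power)
  next
    case (step1 b)
    show ?case using dvd_add[OF step[of b] step1(2)] by (simp add: algebra_simps)
  next
    case (step2 b)
    show ?case using dvd_diff[OF step2(2) step[of "b - 1"]] by (simp add: algebra_simps)
  qed
qed

text \<open>Modulo \<open>p\<close> only the two extreme binomial terms survive, so
  \<open>chebV b p\<close> is congruent to \<open>b ^ p\<close>, and Fermat's congruence
  applies.\<close>

lemma chebV_prime:
  assumes "prime p" "odd p"
  shows "int p dvd chebV b p - b"
proof -
  let ?f = "\<lambda>i. int (p choose i) * chebV b (if 2 * i \<le> p then p - 2 * i else 2 * i - p)"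
  have p: "p > 0" using assms(1) prime_gt_0_nat by blast
  have "{..p} = insert 0 (insert p {0<..<p})" using p by auto
  then have "2 * b ^ p = ?f 0 + ?f p + (\<Sum>i\<in>{0<..<p}. ?f i)"
    unfolding chebV_binomial using p by simp
  then have eq: "2 * b ^ p - 2 * chebV b p = (\<Sum>i\<in>{0<..<p}. ?f i)" using p by simp
  have "int p dvd (\<Sum>i\<in>{0<..<p}. ?f i)"
  proof (intro dvd_sum dvd_mult2)
    fix i assume "i \<in> {0<..<p}"
    then have "p dvd p choose i" using assms(1) by (intro prime_dvd_choose) auto
    then show "int p dvd int (p choose i)" by simp
  qed
  then have "int p dvd 2 * (b ^ p - chebV b p)" using eq by (simp add: algebra_simps)
  moreover have "\<not> int p dvd 2" using assms
    by (metis even_numeral int_dvd_int_iff of_nat_numeral primes_dvd_imp_eq two_is_prime_nat)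
  ultimately have "int p dvd b ^ p - chebV b p"
    using assms(1) by (metis prime_dvd_mult_iff prime_nat_int_transfer)
  from dvd_diff[OF fermat_int[OF assms(1), of b] this] show ?thesis by simp
qed

subsection \<open>Roots modulo a prime divisor of \<open>2 k + 3\<close>\<close>

definition root_poly :: "'a :: comm_ring_1 list \<Rightarrow> 'a poly" where
  "root_poly bs = (\<Prod>b\<leftarrow>bs. [:- b, 1:])"

lemma root_poly_simps [simp]:
  "root_poly [] = 1" "root_poly (b # bs) = [:- b, 1:] * root_poly bs"
  by (simp_all add: root_poly_def)

lemma root_poly_append: "root_poly (as @ bs) = root_poly as * root_poly bs"
  by (simp add: root_poly_def)

lemma root_poly_filter: "root_poly bs = root_poly (filter Q bs) * root_poly (filter (\<lambda>b. \<not> Q b) bs)"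
  by (induction bs) (simp_all add: algebra_simps)

lemma poly_root_poly: "poly (root_poly bs) x = (\<Prod>b\<leftarrow>bs. x - b)"
  by (induction bs) (simp_all add: algebra_simps)

lemma length_eq_sum_filter:
  assumes "finite A" "\<And>b. b \<in> set bs \<Longrightarrow> f b \<in> A"
  shows "length bs = (\<Sum>r\<in>A. length (filter (\<lambda>b. f b = r) bs))"
  using assms(2)
proof (induction bs)
  case (Cons b bs)
  have "(\<Sum>r\<in>A. length (filter (\<lambda>c. f c = r) (b # bs)))
     = (\<Sum>r\<in>A. (if f b = r then 1 else 0) + length (filter (\<lambda>c. f c = r) bs))"
    by (intro sum.cong) auto
  also have "\<dots> = 1 + length bs" using Cons assms(1) by (simp add: sum.distrib)
  finally show ?case by simp
qed simp

context
  fixes k p :: nat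
  assumes p: "prime p" "p dvd 2 * k + 3" and p3: "p = 3 \<Longrightarrow> 9 dvd 2 * k + 3"
begin

lemma odd_p: "odd p"
  using p(2) by (metis dvd_trans even_add even_mult_iff even_numeral odd_numeral)

lemma p_not_dvd_2: "\<not> int p dvd 2"
proof
  assume "int p dvd 2"
  then have "p dvd 2" by (metis int_dvd_int_iff of_nat_numeral)
  then have "p = 2" using p(1) primes_dvd_imp_eq two_is_prime_nat by blast
  with odd_p show False by simp
qed

lemma p_not_dvd_3:
  assumes "p \<noteq> 3"
  shows "\<not> p dvd 3"
proof
  assume "p dvd 3"
  then have "p \<le> 3" by (rule dvd_imp_le) simp
  with assms odd_p prime_ge_2_nat[OF p(1)] show False by (auto simp: le_Suc_eq numeral_3_eq_3)
qed

lemma prime_int_p: "prime (int p)"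
  using p(1) by simp

lemma int_p_dvd: "int p dvd 2 * int k + 3"
  using p(2) by (metis int_dvd_int_iff of_nat_add of_nat_mult of_nat_numeral)

text \<open>By \<open>pderiv_q_0\<close>, six times the derivative is 3 modulo \<open>p\<close>. For
  \<open>p = 3\<close> the identity must first be divided by 3, which is where \<open>p3\<close>
  enters.\<close>

lemma pderiv_q_0_not_dvd: "\<not> int p dvd poly (pderiv (q k)) 0"
proof
  assume a: "int p dvd poly (pderiv (q k)) 0"
  show False
  proof (cases "p = 3")
    case True
    then obtain c where c: "2 * k + 3 = 9 * c" using p3 by blast
    then have "2 * int k + 3 = 9 * int c" by presburger
    then have "6 * poly (pderiv (q k)) 0 = 3 - 9 * int c * (4 * int k ^ 2 + 12 * int k + 11)"
      using pderiv_q_0[of k] by simp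
    then have "2 * poly (pderiv (q k)) 0 = 1 - 3 * (int c * (4 * int k ^ 2 + 12 * int k + 11))" by simp
    moreover obtain e where "poly (pderiv (q k)) 0 = 3 * e" using a True by auto
    ultimately show False by presburger
  next
    case False
    have "int p dvd (2 * int k + 3) * (4 * int k ^ 2 + 12 * int k + 11)" using int_p_dvd by simp
    moreover have "int p dvd 6 * poly (pderiv (q k)) 0" using a by simp
    ultimately have "int p dvd 6 * poly (pderiv (q k)) 0 + (2 * int k + 3) * (4 * int k ^ 2 + 12 * int k + 11)"
      by (rule dvd_add[rotated])
    then have "int p dvd 3" unfolding pderiv_q_0 by simp
    then have "p dvd 3" by (metis int_dvd_int_iff of_nat_numeral)
    with p_not_dvd_3 False show False by blast
  qed
qed

text \<open>By \<open>four_plus_Dp_qc\<close>, a common root of \<open>q k\<close> and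
  \<open>qc k\<close> modulo \<open>p\<close> would make \<open>p\<close> divide 4.\<close>

lemma p_not_dvd_qc:
  assumes "int p dvd poly (q k) r"
  shows "\<not> int p dvd poly (qc k) r"
proof
  assume "int p dvd poly (qc k) r"
  then have "int p dvd poly Dp r * (poly (qc k) r)\<^sup>2" by (simp add: power2_eq_square)
  moreover have "4 + poly Dp r * (poly (qc k) r)\<^sup>2 = poly (q k) r * poly ((4 - X) * (X - 2) * ((X - 2) * q k - 2 * (X - 1) * qc k)) r"
    using arg_cong[OF four_plus_Dp_qc[of k], of "\<lambda>f. poly f r"] by simp
  then have "int p dvd 4 + poly Dp r * (poly (qc k) r)\<^sup>2" using assms by simp
  ultimately have "int p dvd 4" using dvd_add_left_iff by blast
  then have "int p dvd 2 * 2" by simp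
  with p_not_dvd_2 prime_int_p show False using prime_dvd_mult_iff by blast
qed

text \<open>\<open>Kp k\<close> must vanish at \<open>r\<close> modulo \<open>p\<close>, leaving the
  classes of 0, 2 and 6. At 0 the derivative is nonzero, and at 2 it is k + 1 up to sign, which is
  coprime to 2k + 3. For \<open>p = 3\<close> the class of 6 is that of 0.\<close>

lemma double_root_mod_p:
  assumes "int p dvd poly (q k) r" "int p dvd poly (pderiv (q k)) r"
  shows "int p dvd r - 6" "p \<noteq> 3"
proof -
  have "int p dvd poly (Kp k * qc k) r" unfolding Kp_mult_qc using assms by simp
  then have "int p dvd poly (Kp k) r"
    using p_not_dvd_qc[OF assms(1)] prime_int_p by (simp add: prime_dvd_mult_iff)
  moreover have "int p dvd (2 * int k + 3) * (2 * poly Dp r)" using int_p_dvd by simp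
  ultimately have "int p dvd (2 * int k + 3) * (2 * poly Dp r) - poly (Kp k) r" by (rule dvd_diff[rotated])
  also have "(2 * int k + 3) * (2 * poly Dp r) - poly (Kp k) r = r * (r - 2) * (r - 6)"
    by (simp add: Kp_def algebra_simps)
  finally consider "int p dvd r" | "int p dvd r - 2" | "int p dvd r - 6"
    using prime_int_p by (auto simp: prime_dvd_mult_iff)
  moreover have "\<not> int p dvd r" using dvd_poly_cong[of "int p" r 0] assms(2) pderiv_q_0_not_dvd by auto
  moreover have "\<not> int p dvd r - 2"
  proof
    assume "int p dvd r - 2"
    from dvd_poly_cong[OF this assms(2)] have "int p dvd (- 1) ^ Suc k * ((- 1) ^ Suc k * (int k + 1))"
      unfolding pderiv_q_2 by (rule dvd_mult)
    also have "(- 1) ^ Suc k * ((- 1) ^ Suc k * (int k + 1)) = int k + 1"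
      by (cases "even k") simp_all
    finally have "int p dvd int k + 1" .
    then have "int p dvd 2 * int k + 3 - 2 * (int k + 1)" using int_p_dvd by (intro dvd_diff dvd_mult)
    then show False using p(1) by simp
  qed
  ultimately show 6: "int p dvd r - 6" by blast
  show "p \<noteq> 3"
  proof
    assume "p = 3"
    with 6 have "int p dvd r" by presburger
    with \<open>\<not> int p dvd r\<close> show False by blast
  qed
qed

text \<open>A triple root would also be a root of the derivative of \<open>Kp k\<close>, whose value
  at 6 is -24 modulo \<open>p\<close>; but \<open>p\<close> is neither 2 nor 3.\<close>

lemma no_triple_root_mod_p:
  assumes "int p dvd poly (q k) r" "int p dvd poly (pderiv (q k)) r" "int p dvd poly (pderiv (pderiv (q k))) r"
  shows False
proof -
  have r: "int p dvd r - 6" "p \<noteq> 3" using double_root_mod_p[OF assms(1,2)] by auto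
  have "int p dvd poly (Kp k * qc k) r" unfolding Kp_mult_qc using assms by simp
  then have K: "int p dvd poly (Kp k) r"
    using p_not_dvd_qc[OF assms(1)] prime_int_p by (simp add: prime_dvd_mult_iff)
  have "int p dvd poly (pderiv (Kp k * qc k)) r"
    unfolding Kp_mult_qc pderiv_diff pderiv_mult using assms by simp
  then have "int p dvd poly (Kp k) r * poly (pderiv (qc k)) r + poly (qc k) r * poly (pderiv (Kp k)) r"
    by (simp add: pderiv_mult algebra_simps)
  then have "int p dvd poly (qc k) r * poly (pderiv (Kp k)) r"
    using K by (simp add: dvd_add_right_iff)
  then have "int p dvd poly (pderiv (Kp k)) r"
    using p_not_dvd_qc[OF assms(1)] prime_int_p by (simp add: prime_dvd_mult_iff)
  from dvd_poly_cong[OF r(1) this] have "int p dvd poly (pderiv (Kp k)) 6" .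
  also have "poly (pderiv (Kp k)) 6 = (2 * int k + 3) * (2 * poly (pderiv Dp) 6) - 24"
    unfolding Kp_def pderiv_diff pderiv_mult pderiv_of_nat pderiv_X pderiv_numeral by simp
  finally have "int p dvd 24" using int_p_dvd by (simp add: dvd_diff_right_iff)
  also have "(24 :: int) = 2 * 2 * 2 * 3" by simp
  finally have "int p dvd 3" using p_not_dvd_2 prime_int_p by (metis prime_dvd_mult_iff)
  then have "p dvd 3" by (metis int_dvd_int_iff of_nat_numeral)
  with p_not_dvd_3 r(2) show False by blast
qed

text \<open>The prime is now the Chebyshev index in \<open>qc_cheb\<close>. Knowing \<open>v\<close>
  modulo \<open>p\<close>, the Pell identity forces \<open>u\<close> to be 1 or -1 unless
  \<open>b\<close> is 0 or 4. Then \<open>c\<close> is known, and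
  \<open>4 + Dp * (qc k)\<^sup>2\<close> becomes an explicit polynomial in \<open>b\<close>.\<close>

lemma root_mod_p_of_prime:
  assumes "p = 2 * k + 3" "int p dvd poly (q k) b"
  shows "int p dvd b \<or> int p dvd b - 1 \<or> int p dvd b - 2 \<or> int p dvd b - 4"
proof -
  define c u v where "c = poly (qc k) b" and "u = chebU (b - 2) p" and "v = chebV (b - 2) p"
  have c: "2 * c = v + (4 - b) * u" unfolding c_def u_def v_def assms(1) by (rule qc_cheb)
  have v: "int p dvd v - (b - 2)" unfolding v_def by (rule chebV_prime[OF p(1) odd_p])
  have pell: "v\<^sup>2 - ((b - 2)\<^sup>2 - 4) * u\<^sup>2 = 4" unfolding u_def v_def by (rule cheb_pell)
  have D: "int p dvd 4 + poly Dp b * c\<^sup>2"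
    using arg_cong[OF four_plus_Dp_qc[of k], of "\<lambda>f. poly f b"] assms(2) by (simp add: c_def)
  have "b * (b - 4) * ((u - 1) * (u + 1)) = (v - (b - 2)) * (v + (b - 2))"
    using pell by (simp add: algebra_simps power2_eq_square)
  then have "int p dvd b * (b - 4) * ((u - 1) * (u + 1))" using v by simp
  then consider "int p dvd b" | "int p dvd b - 4" | "int p dvd u - 1" | "int p dvd u + 1"
    using prime_int_p by (auto simp: prime_dvd_mult_iff)
  then show ?thesis
  proof cases
    case 3
    \<comment> \<open>For \<open>u\<close> congruent to 1, \<open>c\<close> is congruent to
      1.\<close>
    have "2 * (c - 1) = (v - (b - 2)) + (4 - b) * (u - 1)" using c by algebra
    then have "int p dvd 2 * (c - 1)" using dvd_add[OF v dvd_mult[OF 3, of "4 - b"]] by (simp only:)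
    then have "int p dvd c - 1" using p_not_dvd_2 prime_dvd_mult_iff[OF prime_int_p] by blast
    moreover have "b * (b - 2) * (b - 4) = (4 + poly Dp b * c\<^sup>2) - poly Dp b * (c + 1) * (c - 1)"
      by (simp add: Dp_def algebra_simps power2_eq_square)
    ultimately have "int p dvd b * (b - 2) * (b - 4)" using D by simp
    then show ?thesis using prime_int_p by (auto simp: prime_dvd_mult_iff)
  next
    case 4
    \<comment> \<open>For \<open>u\<close> congruent to -1, \<open>c\<close> is congruent to
      \<open>b - 3\<close>.\<close>
    have "2 * (c - (b - 3)) = (v - (b - 2)) + (4 - b) * (u + 1)" using c by algebra
    then have "int p dvd 2 * (c - (b - 3))" using dvd_add[OF v dvd_mult[OF 4, of "4 - b"]] by (simp only:)
    then have "int p dvd c - (b - 3)" using p_not_dvd_2 prime_dvd_mult_iff[OF prime_int_p] by blast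
    moreover have "(b - 2) * ((b - 4) * (b - 4)) * ((b - 1) * (b - 1)) = (4 + poly Dp b * c\<^sup>2) - poly Dp b * (c + (b - 3)) * (c - (b - 3))"
      by (simp add: Dp_def algebra_simps power2_eq_square)
    ultimately have "int p dvd (b - 2) * ((b - 4) * (b - 4)) * ((b - 1) * (b - 1))" using D by simp
    then show ?thesis using prime_int_p by (auto simp: prime_dvd_mult_iff)
  qed auto
qed

lemma q_not_split_mod_p:
  assumes k: "k \<ge> 2" and bs: "length bs = 2 * k + 2" and eq: "[:int p:] dvd q k - root_poly bs"
  shows False
proof -
  obtain E where "q k - root_poly bs = [:int p:] * E" using eq by (rule dvdE)
  then have E: "q k = root_poly bs + [:int p:] * E" by (simp add: algebra_simps)
  have d1: "pderiv (q k) = pderiv (root_poly bs) + [:int p:] * pderiv E"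
    unfolding E by (simp add: pderiv_add pderiv_smult)
  have d2: "pderiv (pderiv (q k)) = pderiv (pderiv (root_poly bs)) + [:int p:] * pderiv (pderiv E)"
    unfolding d1 by (simp add: pderiv_add pderiv_smult)
  have root: "int p dvd poly (q k) b" if "b \<in> set bs" for b
  proof -
    have "poly (root_poly bs) b = 0" using that by (auto simp: poly_root_poly prod_list_zero_iff)
    then show ?thesis unfolding E by simp
  qed
  have dvd: "int p dvd r - b" if "b mod int p = r mod int p" for b r
    using that by (metis mod_eq_dvd_iff)
  \<comment> \<open>The list of roots is sorted into residue classes; \<open>M r\<close> collects
    the factors outside the class of \<open>r\<close>.\<close>
  define F where "F r = filter (\<lambda>b. b mod int p = r) bs" for r
  define M where "M r = root_poly (filter (\<lambda>b. b mod int p \<noteq> r) bs)" for r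
  have le2: "length (F r) \<le> 2" and le1: "length (F r) \<le> 1 \<or> int p dvd r - 6 \<and> p \<noteq> 3" if r: "r \<in> {0..<int p}" for r
  proof -
    have bs': "root_poly bs = root_poly (F r) * M r" unfolding F_def M_def by (rule root_poly_filter)
    have F: "int p dvd r - b" if "b \<in> set (F r)" for b using that r dvd[of b r] by (simp add: F_def)
    \<comment> \<open>Three factors congruent to X - r make \<open>q k\<close> and its first two
      derivatives vanish at \<open>r\<close> modulo \<open>p\<close>.\<close>
    show "length (F r) \<le> 2"
    proof (rule ccontr)
      assume "\<not> ?thesis"
      then have "Suc (Suc (Suc 0)) \<le> length (F r)" by simp
      then obtain a b c cs where abc: "F r = a # b # c # cs" by (auto simp: Suc_le_length_iff)
      define N where "N = root_poly cs * M r"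
      have 1: "root_poly bs = [:- a, 1:] * ([:- b, 1:] * ([:- c, 1:] * N))" unfolding bs' abc N_def by (simp only: root_poly_simps mult_ac)
      have dv: "int p dvd r - a" "int p dvd r - b" "int p dvd r - c" using F abc by auto
      have "int p dvd poly (q k) r" unfolding E 1 using dv by (simp del: mult_pCons_left)
      moreover have "int p dvd poly (pderiv (q k)) r" unfolding d1 1 pderiv_mult using dv by (simp add: pderiv_pCons del: mult_pCons_left)
      moreover have "int p dvd poly (pderiv (pderiv (q k))) r" unfolding d2 1 pderiv_mult pderiv_add using dv by (simp add: pderiv_pCons del: mult_pCons_left)
      ultimately show False by (rule no_triple_root_mod_p)
    qed
    show "length (F r) \<le> 1 \<or> int p dvd r - 6 \<and> p \<noteq> 3"
    proof (cases "length (F r) \<le> 1")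
      case False
      then have "Suc (Suc 0) \<le> length (F r)" by simp
      then obtain a b cs where ab: "F r = a # b # cs" by (auto simp: Suc_le_length_iff)
      define N where "N = root_poly cs * M r"
      have 1: "root_poly bs = [:- a, 1:] * ([:- b, 1:] * N)" unfolding bs' ab N_def by (simp only: root_poly_simps mult_ac)
      have dv: "int p dvd r - a" "int p dvd r - b" using F ab by auto
      have "int p dvd poly (q k) r" unfolding E 1 using dv by (simp del: mult_pCons_left)
      moreover have "int p dvd poly (pderiv (q k)) r" unfolding d1 1 pderiv_mult using dv by (simp add: pderiv_pCons del: mult_pCons_left)
      ultimately show ?thesis using double_root_mod_p by blast
    qed simp
  qed
  have p0: "int p > 0" using p(1) prime_gt_0_nat by simp
  have bound: "length (F r) \<le> 1 + (if r = 6 mod int p then 1 else 0)" if r: "r \<in> {0..<int p}" for r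
    using le1[OF r] le2[OF r] r by (auto simp: mod_eq_dvd_iff[symmetric])
  \<comment> \<open>Each of the \<open>p\<close> classes holds at most one root, and the class of 6
    at most one more.\<close>
  have "length bs = (\<Sum>r\<in>{0..<int p}. length (F r))"
    unfolding F_def by (rule length_eq_sum_filter) (use p0 in auto)
  also have "\<dots> \<le> (\<Sum>r\<in>{0..<int p}. 1 + (if r = 6 mod int p then 1 else 0))"
    by (rule sum_mono) (rule bound)
  also have "\<dots> = p + 1" unfolding sum.distrib using p0 by simp
  finally have le: "2 * k + 2 \<le> p + 1" using bs by simp
  \<comment> \<open>The cofactor is odd, and 3 or more would give 3p <= 2k + 3 <= p + 2, impossible
    for a prime.\<close>
  obtain m where m: "2 * k + 3 = p * m" using p(2) by blast
  have "odd m" using m by (metis even_add even_mult_iff even_numeral odd_numeral)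
  have "m = 1"
  proof (rule ccontr)
    assume "m \<noteq> 1"
    with \<open>odd m\<close> have "m \<ge> 3" by (auto elim!: oddE)
    then have "p * 3 \<le> 2 * k + 3" unfolding m by simp
    with le prime_ge_2_nat[OF p(1)] show False by linarith
  qed
  with m have pk: "p = 2 * k + 3" by simp
  then have p7: "p \<ge> 7" using k by simp
  have cls: "b mod int p \<in> {0, 1, 2, 4}" if "b \<in> set bs" for b
  proof -
    have "b mod int p = 0 mod int p \<or> b mod int p = 1 mod int p \<or> b mod int p = 2 mod int p \<or> b mod int p = 4 mod int p"
      using root_mod_p_of_prime[OF pk root[OF that]] unfolding mod_eq_dvd_iff by simp
    then show ?thesis using p7 by auto
  qed
  \<comment> \<open>Only four classes remain. As \<open>p\<close> is at least 7, none of them is the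
    class of 6, so there are at most 4 roots, fewer than 2k + 2.\<close>
  have "length bs = (\<Sum>r\<in>{0, 1, 2, 4}. length (F r))"
    unfolding F_def by (rule length_eq_sum_filter) (use cls in auto)
  also have "\<dots> \<le> (\<Sum>r\<in>{0, 1, 2, 4 :: int}. 1)"
  proof (rule sum_mono)
    fix r :: int assume r: "r \<in> {0, 1, 2, 4}"
    then have "r \<in> {0..<int p}" "r \<noteq> 6 mod int p" using p7 by auto
    then show "length (F r) \<le> 1" using bound[of r] by simp
  qed
  finally show False using bs k by simp
qed

end

subsection \<open>Splitting modulo a prime with a simple root\<close>

lemma poly_taylor_dvd: "(y :: int)\<^sup>2 dvd poly f (a + y) - poly f a - y * poly (pderiv f) a"
proof (induction f)
  case (pCons c f)
  have "poly (pCons c f) (a + y) - poly (pCons c f) a - y * poly (pderiv (pCons c f)) a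
    = a * (poly f (a + y) - poly f a - y * poly (pderiv f) a) + y * (poly f (a + y) - poly f a)"
    by (simp add: pderiv_pCons algebra_simps)
  moreover have "y * y dvd y * (poly f (a + y) - poly f a)"
    using poly_diff_dvd[of "a + y" a f] by (intro mult_dvd_mono) simp_all
  ultimately show ?case using pCons by (simp add: power2_eq_square)
qed simp

lemma inverse_mod_prime:
  fixes p a :: int
  assumes "prime p" "\<not> p dvd a"
  obtains w where "p dvd w * a - 1"
proof -
  have "coprime a p" using assms by (metis coprime_commute prime_imp_coprime)
  then obtain u v where "u * a + v * p = 1" using bezout_int[of a p] by auto
  then have "u * a - 1 = p * (- v)" by (simp add: algebra_simps)
  then show ?thesis by (intro that[of u]) simp
qed

text \<open>Newton iteration. Keeping \<open>a\<close> divisible by \<open>p\<close> ensures that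
  the derivative at \<open>a\<close> stays a unit modulo \<open>p\<close>.\<close>

lemma hensel_root:
  fixes p :: int
  assumes p: "prime p" and P: "p dvd poly P 0" "\<not> p dvd poly (pderiv P) 0"
  shows "\<exists>a. p dvd a \<and> p ^ M dvd poly P a"
proof (induction M)
  case 0
  show ?case by (intro exI[of _ 0]) simp
next
  case (Suc M)
  show ?case
  proof (cases "M = 0")
    case True
    then show ?thesis using P by (intro exI[of _ 0]) simp
  next
    case False
    obtain a where a: "p dvd a" "p ^ M dvd poly P a" using Suc by blast
    then obtain s where s: "poly P a = p ^ M * s" by (auto elim: dvdE)
    have "\<not> p dvd poly (pderiv P) a" using dvd_poly_cong[of p a 0 "pderiv P"] a(1) P(2) by auto
    then obtain w where w: "p dvd w * poly (pderiv P) a - 1" by (rule inverse_mod_prime[OF p])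
    \<comment> \<open>The Newton correction. An inverse of the derivative modulo \<open>p\<close>
      alone suffices, since each round gains one factor \<open>p\<close>.\<close>
    define y where "y = - (p ^ M * s * w)"
    have "p * p ^ M dvd y\<^sup>2"
    proof -
      have "p dvd p ^ M" using False by (simp add: dvd_power)
      then have "p * p ^ M dvd p ^ M * p ^ M" by (rule mult_dvd_mono) simp
      also have "\<dots> dvd y\<^sup>2" unfolding y_def power2_eq_square by (intro mult_dvd_mono) simp_all
      finally show ?thesis .
    qed
    then have 1: "p * p ^ M dvd poly P (a + y) - poly P a - y * poly (pderiv P) a"
      using poly_taylor_dvd dvd_trans by blast
    have "poly P a + y * poly (pderiv P) a = - (p ^ M * s * (w * poly (pderiv P) a - 1))"
      unfolding s y_def by (simp add: algebra_simps)
    moreover have "p * p ^ M dvd p ^ M * s * (w * poly (pderiv P) a - 1)"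
      using mult_dvd_mono[OF w, of "p ^ M" "p ^ M * s"] by (simp add: mult_ac)
    ultimately have 2: "p * p ^ M dvd poly P a + y * poly (pderiv P) a" by simp
    have "p ^ Suc M dvd poly P (a + y)" using dvd_add[OF 1 2] by (simp add: algebra_simps)
    moreover have "p dvd a + y" using a(1) False by (simp add: y_def dvd_power)
    ultimately show ?thesis by blast
  qed
qed

lemma degree_root_poly [simp]: "degree (root_poly (cs :: 'a :: idom list)) = length cs"
proof (induction cs)
  case (Cons c cs)
  have "root_poly cs \<noteq> 0" by (induction cs) (simp_all del: mult_pCons_left)
  with Cons show ?case by (simp add: degree_mult_eq del: mult_pCons_left)
qed simp

lemma coeff_root_poly_scale:
  fixes s :: "'a :: idom"
  assumes "j \<le> length cs"
  shows "coeff (root_poly (map ((*) s) cs)) j = s ^ (length cs - j) * coeff (root_poly cs) j"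
  using assms
proof (induction cs arbitrary: j)
  case (Cons c cs)
  show ?case
  proof (cases j)
    case 0
    then show ?thesis using Cons.IH[of 0] by (simp add: mult_ac)
  next
    case (Suc i)
    show ?thesis
    proof (cases "Suc i \<le> length cs")
      case True
      then have "length cs - i = Suc (length cs - Suc i)" by simp
      then show ?thesis using Suc True Cons.IH[of i] Cons.IH[of "Suc i"]
        by (simp add: algebra_simps)
    next
      case False
      then show ?thesis using Suc Cons.prems Cons.IH[of i] by (simp add: coeff_eq_0)
    qed
  qed
qed simp

lemma map_poly_root_poly:
  fixes f :: "'a :: comm_ring_1 \<Rightarrow> 'b :: comm_ring_1"
  assumes "f 0 = 0" "f 1 = 1" "\<And>a b. f (a + b) = f a + f b" "\<And>a b. f (a * b) = f a * f b"
  shows "map_poly f (root_poly cs) = root_poly (map f cs)"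
proof (induction cs)
  case Nil
  then show ?case using assms by (simp add: one_pCons map_poly_pCons)
next
  case (Cons c cs)
  have "f c + f (- c) = 0" using assms(3)[of c "- c"] assms(1) by simp
  then have "f (- c) = - f c" by (simp add: add_eq_0_iff)
  then have "map_poly f [:- c, 1:] = [:- f c, 1:]" using assms by (simp add: map_poly_pCons)
  then show ?case using Cons map_poly_hom_mult[of f, OF assms(1,3,4)]
    by (simp del: mult_pCons_left)
qed

text \<open>A finite-precision form of integral closedness at \<open>p\<close>: the sum is D^n
  f(c/D) with \<open>f\<close> monic, so its divisibility bounds the valuation of \<open>c\<close>
  below by \<open>e\<close>. The power of \<open>p\<close> known to divide \<open>c\<close> is
  raised one step at a time.\<close>

lemma dvd_of_dvd_homogeneous_eval:
  fixes p D c :: int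
  assumes p: "prime p" and n: "n > 0" and f: "f n = 1"
    and dvd: "p ^ (n * e) dvd (\<Sum>j\<le>n. f j * D ^ (n - j) * c ^ j)" and D: "p ^ e dvd D"
  shows "p ^ e dvd c"
proof -
  have "p ^ v dvd c" if "v \<le> e" for v
    using that
  proof (induction v)
    case (Suc v)
    then obtain c' where c: "c = p ^ v * c'" by (auto elim: dvdE)
    \<comment> \<open>Since v < e, \<open>D\<close> has one more factor \<open>p\<close> than was
      removed from \<open>c\<close>, so every term but the leading one is divisible by
      \<open>p\<close> after division.\<close>
    obtain D' where D': "D = p ^ v * (p * D')"
      using D Suc.prems by (metis dvdE dvd_trans le_imp_power_dvd mult.assoc power_Suc2)
    define S where "S = (\<Sum>j<n. f j * (p * D') ^ (n - j) * c' ^ j)"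
    have "(\<Sum>j\<le>n. f j * D ^ (n - j) * c ^ j) = (\<Sum>j\<le>n. (p ^ v) ^ n * (f j * (p * D') ^ (n - j) * c' ^ j))"
    proof (intro sum.cong refl)
      fix j assume "j \<in> {..n}"
      then have "(p ^ v) ^ n = (p ^ v) ^ (n - j) * (p ^ v) ^ j" by (simp add: power_add[symmetric])
      then show "f j * D ^ (n - j) * c ^ j = (p ^ v) ^ n * (f j * (p * D') ^ (n - j) * c' ^ j)"
        unfolding c D' by (simp add: power_mult_distrib mult_ac)
    qed
    also have "\<dots> = (p ^ v) ^ n * (\<Sum>j\<le>n. f j * (p * D') ^ (n - j) * c' ^ j)" by (simp add: sum_distrib_left)
    also have "\<dots> = (p ^ v) ^ n * (S + c' ^ n)"
      using n f by (simp add: S_def lessThan_Suc_atMost[symmetric])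
    finally have eq: "(\<Sum>j\<le>n. f j * D ^ (n - j) * c ^ j) = (p ^ v) ^ n * (S + c' ^ n)" .
    have "v * n + 1 \<le> n * e" using Suc.prems n
      by (metis Suc_eq_plus1 Suc_le_eq mult.commute mult_less_mono2)
    then have "p ^ (v * n + 1) dvd (p ^ v) ^ n * (S + c' ^ n)"
      using dvd unfolding eq by (meson dvd_trans le_imp_power_dvd)
    then have "p dvd S + c' ^ n" using p by (simp add: power_mult[symmetric])
    moreover have "p dvd S" unfolding S_def
      by (intro dvd_sum dvd_mult2 dvd_mult) (simp add: power_mult_distrib dvd_power)
    ultimately have "p dvd c' ^ n" by (simp add: dvd_add_right_iff)
    then have "p dvd c'" using p prime_dvd_power by blast
    then show ?case unfolding c by (simp add: mult.commute mult_dvd_mono)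
  qed simp
  then show ?thesis by simp
qed

section \<open>Rational polynomials and clearing denominators\<close>

abbreviation (input) rp :: "rat poly \<Rightarrow> complex poly" where
  "rp \<equiv> map_poly of_rat"

lemma rp_simps [simp]:
  "rp (f + g) = rp f + rp g" "rp (f - g) = rp f - rp g" "rp (f * g) = rp f * rp g" "rp (- f) = - rp f"
  "rp 1 = 1" "rp (pCons r f) = pCons (of_rat r) (rp f)" "rp (ip h) = ip h"
proof -
  show "rp (f * g) = rp f * rp g" by (rule map_poly_hom_mult) (simp_all add: of_rat_add of_rat_mult)
qed (auto intro!: poly_eqI simp: coeff_map_poly of_rat_add of_rat_diff of_rat_minus one_pCons map_poly_pCons)

lemma rat_poly_clear_denominators:
  fixes f :: "rat poly"
  shows "\<exists>D > 0. \<exists>h. [:of_int D:] * f = ip h"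
proof (induction f)
  case 0
  show ?case by (intro exI[of _ 1] conjI exI[of _ 0]) simp_all
next
  case (pCons r f)
  then obtain D h where D: "D > 0" "[:of_int D:] * f = ip h" by blast
  obtain a b where ab: "r = Rat.Fract a b" "b > 0" by (metis Rat_cases)
  have "of_int b * r = of_int a" using ab by (simp add: Fract_of_int_quotient)
  then have "[:of_int (b * D):] * pCons r f = [:of_int (a * D):] + [:of_int b:] * pCons 0 ([:of_int D:] * f)"
    by (simp add: algebra_simps)
  also have "\<dots> = ip ([:a * D:] + [:b:] * pCons 0 h)"
    unfolding D by (simp only: ip_simps ip_pCons map_poly_0 of_int_0)
  finally show ?case using ab D by (metis mult_pos_pos)
qed

lemma clear_denominators:
  "\<exists>D > 0. \<exists>h. of_int D * poly (rp f) z = poly (ip h) z"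
proof -
  obtain D h where D: "D > 0" "[:of_int D:] * f = ip h" using rat_poly_clear_denominators by blast
  have "poly (rp ([:of_int D:] * f)) z = poly (ip h) z" unfolding D by simp
  then have "of_int D * poly (rp f) z = poly (ip h) z" by (simp only: rp_simps poly_mult) simp
  with D show ?thesis by blast
qed

lemma common_denominator:
  assumes "\<And>z. z \<in> set zs \<Longrightarrow> \<exists>f. z = poly (rp f) x"
  shows "\<exists>D > 0. \<exists>hs. map ((*) (of_int D)) zs = map (\<lambda>h. poly (ip h) x) hs"
  using assms
proof (induction zs)
  case Nil
  show ?case by (intro exI[of _ 1] conjI exI[of _ "[]"]) simp_all
next
  case (Cons z zs)
  then obtain D hs where D: "D > 0" "map ((*) (of_int D)) zs = map (\<lambda>h. poly (ip h) x) hs" by auto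
  obtain D1 h where D1: "D1 > 0" "of_int D1 * z = poly (ip h) x"
    using Cons.prems[of z] clear_denominators by (metis list.set_intros(1))
  have sc: "poly (ip ([:c:] * h)) x = of_int c * poly (ip h) x" for c h
    by (simp only: ip_simps ip_pCons poly_mult poly_pCons map_poly_0) simp
  have "map ((*) (of_int (D1 * D))) (z # zs) = of_int D * (of_int D1 * z) # map ((*) (of_int D1)) (map ((*) (of_int D)) zs)"
    by (simp add: mult_ac)
  also have "\<dots> = map (\<lambda>h. poly (ip h) x) ([:D:] * h # map ((*) [:D1:]) hs)"
    unfolding D D1 by (simp only: list.map map_map o_def sc)
  finally show ?case using D D1 by (metis mult_pos_pos)
qed

text \<open>The roots of \<open>P\<close> are polynomials in \<open>x\<close> over a common
  denominator \<open>D\<close>. Replacing \<open>x\<close> by an integer \<open>a\<close> close to a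
  p-adic root of \<open>P\<close> turns them into approximate p-adic roots, which are then reduced
  modulo \<open>p\<close>.\<close>

lemma split_mod_prime:
  fixes P :: "int poly" and x :: complex and p :: int
  assumes p: "prime p" and P: "lead_coeff P = 1" "p dvd poly P 0" "\<not> p dvd poly (pderiv P) 0"
    and min: "\<And>F :: int poly. poly (ip F) x = 0 \<Longrightarrow> P dvd F"
    and fac: "ip P = root_poly zs"
    and conj: "\<And>z. z \<in> set zs \<Longrightarrow> \<exists>f. z = poly (rp f) x"
  shows "\<exists>bs. length bs = degree P \<and> [:p:] dvd P - root_poly bs"
proof -
  define n where "n = degree P"
  have zs: "length zs = n" using arg_cong[OF fac, of degree] by (simp add: n_def)
  have n0: "n > 0"
  proof (rule ccontr)
    assume "\<not> n > 0"
    then have "degree P = 0" by (simp add: n_def)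
    then have "pderiv P = 0" by (simp add: pderiv_eq_0_iff)
    with P(3) show False by simp
  qed
  obtain D hs where D: "D > 0" and hs: "map ((*) (of_int D)) zs = map (\<lambda>h. poly (ip h) x) hs"
    using common_denominator[of zs x, OF conj] by blast
  have lhs: "length hs = n" using arg_cong[OF hs, of length] zs by simp
  have "\<not> is_unit p" using p prime_elem_not_unit prime_imp_prime_elem by blast
  then obtain D' where D': "D = p ^ multiplicity p D * D'" "\<not> p dvd D'"
    using multiplicity_decompose'[of D p] D by auto
  define e where "e = multiplicity p D"
  note D' = D'[folded e_def]
  \<comment> \<open>Division by \<open>p ^ e\<close> costs at most n * e factors \<open>p\<close> in
    any coefficient, so this precision leaves one factor to spare.\<close>
  obtain a where a: "p ^ (n * e + 1) dvd poly P a" using hensel_root[OF p P(2,3)] by blast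
  define cs where "cs = map (\<lambda>h. poly h a) hs"
  have lcs: "length cs = n" by (simp add: cs_def lhs)
  \<comment> \<open>Both \<open>x\<close> and the approximate root \<open>a\<close> evaluate the coefficients of the polynomial
    with roots \<open>hs\<close>, and an integer relation at \<open>x\<close> persists at \<open>a\<close>.\<close>
  have key: "p ^ (n * e + 1) dvd coeff (root_poly cs) j - D ^ (n - j) * coeff P j" if j: "j \<le> n" for j
  proof -
    have "map_poly (\<lambda>h. poly (ip h) x) (root_poly hs) = root_poly (map (\<lambda>h. poly (ip h) x) hs)"
      by (rule map_poly_root_poly) simp_all
    then have "poly (ip (coeff (root_poly hs) j)) x = coeff (root_poly (map ((*) (of_int D)) zs)) j"
      unfolding hs by (metis coeff_map_poly map_poly_0 poly_0)
    also have "\<dots> = of_int D ^ (n - j) * coeff (root_poly zs) j"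
      using coeff_root_poly_scale[of j zs "of_int D"] j zs by simp
    also have "\<dots> = of_int (D ^ (n - j) * coeff P j)" unfolding fac[symmetric] by (simp add: coeff_map_poly)
    finally have "poly (ip (coeff (root_poly hs) j - [:D ^ (n - j) * coeff P j:])) x = 0"
      by simp
    then have "P dvd coeff (root_poly hs) j - [:D ^ (n - j) * coeff P j:]" by (rule min)
    then obtain Q where "coeff (root_poly hs) j - [:D ^ (n - j) * coeff P j:] = P * Q" by (rule dvdE)
    then have "poly (coeff (root_poly hs) j) a - D ^ (n - j) * coeff P j = poly P a * poly Q a"
      by (metis (no_types, lifting) poly_diff poly_mult poly_const_conv)
    moreover have "map_poly (\<lambda>h. poly h a) (root_poly hs) = root_poly cs"
      unfolding cs_def by (rule map_poly_root_poly) simp_all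
    then have "poly (coeff (root_poly hs) j) a = coeff (root_poly cs) j"
      by (metis coeff_map_poly poly_0)
    ultimately show ?thesis using a by simp
  qed
  \<comment> \<open>Evaluating \<open>root_poly cs\<close> at its own root \<open>c\<close> shows
    that D^n P(c/D) is highly divisible by \<open>p\<close>; as \<open>P\<close> is monic, c /
    \<open>p ^ e\<close> is integral.\<close>
  have cdvd: "p ^ e dvd c" if "c \<in> set cs" for c
  proof (rule dvd_of_dvd_homogeneous_eval[OF p n0, of "coeff P"])
    show "coeff P n = 1" using P(1) by (simp add: n_def)
    show "p ^ e dvd D" using D'(1) by simp
    have "p ^ (n * e + 1) dvd (\<Sum>j\<le>n. (coeff (root_poly cs) j - D ^ (n - j) * coeff P j) * c ^ j)"
      using key by (intro dvd_sum dvd_mult2) auto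
    also have "\<dots> = poly (root_poly cs) c - (\<Sum>j\<le>n. coeff P j * D ^ (n - j) * c ^ j)"
      unfolding poly_altdef by (simp add: lcs sum_subtractf algebra_simps)
    also have "poly (root_poly cs) c = 0" using that by (auto simp: poly_root_poly prod_list_zero_iff)
    finally show "p ^ (n * e) dvd (\<Sum>j\<le>n. coeff P j * D ^ (n - j) * c ^ j)"
      by (simp add: dvd_mult_right)
  qed
  define cs' where "cs' = map (\<lambda>c. c div p ^ e) cs"
  have cs': "cs = map ((*) (p ^ e)) cs'" unfolding cs'_def map_map o_def
    using cdvd by (intro map_idI[symmetric]) auto
  have lcs': "length cs' = n" by (simp add: cs'_def lcs)
  have key': "p dvd coeff (root_poly cs') j - D' ^ (n - j) * coeff P j" if j: "j \<le> n" for j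
  proof -
    have "coeff (root_poly cs) j - D ^ (n - j) * coeff P j
        = p ^ (e * (n - j)) * (coeff (root_poly cs') j - D' ^ (n - j) * coeff P j)"
      unfolding cs' power_mult using coeff_root_poly_scale[of j cs' "p ^ e"] j
      by (subst D'(1)) (simp add: lcs' power_mult_distrib algebra_simps)
    with key[OF j] have "p ^ (n * e + 1) dvd p ^ (e * (n - j)) * (coeff (root_poly cs') j - D' ^ (n - j) * coeff P j)"
      by simp
    moreover have "e * (n - j) + 1 \<le> n * e + 1" by (simp add: mult.commute)
    ultimately have "p ^ (e * (n - j) + 1) dvd p ^ (e * (n - j)) * (coeff (root_poly cs') j - D' ^ (n - j) * coeff P j)"
      by (meson dvd_trans le_imp_power_dvd)
    then show ?thesis using p by simp
  qed
  \<comment> \<open>The part of \<open>D\<close> prime to \<open>p\<close> is inverted modulo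
    \<open>p\<close>, which completes the division by \<open>D\<close>.\<close>
  obtain w where w: "p dvd w * D' - 1" by (rule inverse_mod_prime[OF p D'(2)])
  define bs where "bs = map ((*) w) cs'"
  have "p dvd coeff (P - root_poly bs) j" for j
  proof (cases "j \<le> n")
    case True
    have "w * D' - 1 dvd (w * D') ^ (n - j) - 1"
      using poly_diff_dvd[of "w * D'" 1 "monom 1 (n - j)"] by (simp add: poly_monom)
    with w have 1: "p dvd (w * D') ^ (n - j) - 1" by (rule dvd_trans)
    have "coeff (P - root_poly bs) j = - (w ^ (n - j) * (coeff (root_poly cs') j - D' ^ (n - j) * coeff P j))
        - ((w * D') ^ (n - j) - 1) * coeff P j"
      using coeff_root_poly_scale[of j cs' w] True
      by (simp add: bs_def lcs' power_mult_distrib algebra_simps)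
    then show ?thesis using key'[OF True] 1 by simp
  next
    case False
    then show ?thesis by (simp add: coeff_eq_0 n_def[symmetric] bs_def lcs')
  qed
  then have "[:p:] dvd P - root_poly bs" by (simp add: const_poly_dvd_iff)
  moreover have "length bs = degree P" by (simp add: bs_def lcs' n_def)
  ultimately show ?thesis by blast
qed

subsection \<open>Conjugates of \<open>d k\<close>\<close>

lemma minimal_polynomial_exists:
  fixes x :: complex
  assumes "f \<noteq> 0" "poly (rp f) x = 0"
  obtains A :: "rat poly" where "lead_coeff A = 1" "irreducible A" "poly (rp A) x = 0"
    "\<And>F. poly (rp F) x = 0 \<Longrightarrow> A dvd F"
proof -
  let ?V = "\<lambda>f. f \<noteq> 0 \<and> poly (rp f) x = 0"
  obtain B where B: "?V B" "\<And>g. ?V g \<Longrightarrow> degree B \<le> degree g"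
    using ex_has_least_nat[of ?V f degree] assms by blast
  define A where "A = smult (inverse (lead_coeff B)) B"
  have A: "lead_coeff A = 1" "degree A = degree B" using B(1) by (simp_all add: A_def)
  then have A0: "A \<noteq> 0" by auto
  have "A = [:inverse (lead_coeff B):] * B" by (simp add: A_def)
  then have Ax: "poly (rp A) x = 0" using B(1) by (simp only: rp_simps poly_mult) simp
  have dvd: "A dvd F" if "poly (rp F) x = 0" for F
  proof -
    have "rp F = rp (F div A) * rp A + rp (F mod A)"
      by (metis div_mult_mod_eq rp_simps(1) rp_simps(3))
    then have "poly (rp (F mod A)) x = 0" using that Ax by simp
    moreover have "F mod A = 0 \<or> degree (F mod A) < degree A" using A0 by (rule degree_mod_less)
    ultimately have "F mod A = 0" using B(2)[of "F mod A"] A(2) by (metis not_le)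
    then show ?thesis by (simp add: dvd_eq_mod_eq_0)
  qed
  have "irreducible A"
  proof (rule irreducibleI)
    show "A \<noteq> 0" by fact
    show "\<not> is_unit A"
    proof
      assume "is_unit A"
      then obtain c where "A = [:c:]" by (auto simp: is_unit_poly_iff)
      with Ax A0 show False by simp
    qed
    fix a b assume ab: "A = a * b"
    then have nz: "a \<noteq> 0" "b \<noteq> 0" using A0 by auto
    then have deg: "degree A = degree a + degree b" unfolding ab by (rule degree_mult_eq)
    have "poly (rp a) x = 0 \<or> poly (rp b) x = 0" using Ax unfolding ab by simp
    then have "degree b = 0 \<or> degree a = 0" using B(2)[of a] B(2)[of b] nz deg A(2) by auto
    then show "is_unit a \<or> is_unit b" using nz by (auto simp: is_unit_iff_degree)
  qed
  with A Ax dvd show ?thesis using that by blast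
qed

text \<open>Gauss's lemma by contents: after clearing denominators the contents are at most the
  leading coefficients \<open>a\<close> and \<open>b\<close>, while their product is
  \<open>a * b\<close>. Both bounds are therefore equalities and the primitive parts are the monic
  factors.\<close>

lemma monic_rat_factor_is_int:
  fixes A :: "rat poly" and Q :: "int poly"
  assumes A: "lead_coeff A = 1" "A dvd ip Q" and Q: "lead_coeff Q = 1"
  obtains P C :: "int poly" where "A = ip P" "Q = P * C" "lead_coeff P = 1" "lead_coeff C = 1"
proof -
  obtain B where B: "ip Q = A * B" using A(2) by (rule dvdE)
  have "lead_coeff (ip Q :: rat poly) = 1" unfolding lead_coeff_ip Q by simp
  then have lB: "lead_coeff B = 1" unfolding B lead_coeff_mult A(1) by simp
  obtain a A0 where a: "a > 0" "[:of_int a:] * A = ip A0" using rat_poly_clear_denominators by blast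
  obtain b B0 where b: "b > 0" "[:of_int b:] * B = ip B0" using rat_poly_clear_denominators by blast
  have "ip (A0 * B0) = (ip ([:a * b:] * Q) :: rat poly)"
    unfolding ip_simps ip_pCons a(2)[symmetric] b(2)[symmetric] B by (simp add: mult_ac)
  then have AB: "A0 * B0 = smult (a * b) Q" by (simp only: ip_eq_iff) simp
  have "content Q dvd lead_coeff Q" by (rule content_dvd_coeff)
  then have "content Q = 1" using Q by (metis is_unit_normalize normalize_content)
  then have cc: "content A0 * content B0 = a * b" using arg_cong[OF AB, of content] a(1) b(1)
    by (simp add: content_mult abs_mult)
  have lA0: "lead_coeff A0 = a"
  proof -
    have "lead_coeff (ip A0 :: rat poly) = of_int a" unfolding a(2)[symmetric] lead_coeff_mult A(1) by simp
    then show ?thesis unfolding lead_coeff_ip by simp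
  qed
  have lB0: "lead_coeff B0 = b"
  proof -
    have "lead_coeff (ip B0 :: rat poly) = of_int b" unfolding b(2)[symmetric] lead_coeff_mult lB by simp
    then show ?thesis unfolding lead_coeff_ip by simp
  qed
  have le: "content A0 \<le> a" "content B0 \<le> b"
    using content_dvd_coeff[of A0 "degree A0"] content_dvd_coeff[of B0 "degree B0"] a(1) b(1)
    unfolding lA0 lB0 by (auto intro: zdvd_imp_le)
  have nonneg: "0 \<le> content A0" "0 \<le> content B0"
    by (metis abs_ge_zero normalize_content normalize_int_def)+
  have cA: "content A0 = a"
  proof (rule ccontr)
    assume "content A0 \<noteq> a"
    then have "content A0 < a" using le by simp
    then have "content A0 * content B0 < a * b" using le nonneg b(1)
      by (metis mult_less_le_imp_less mult_strict_right_mono mult_left_mono le_less_trans)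
    with cc show False by simp
  qed
  then have cB: "content B0 = b" using cc a(1) by simp
  define P C where "P = primitive_part A0" and "C = primitive_part B0"
  have "A0 = [:a:] * P" using content_times_primitive_part[of A0] by (simp add: P_def cA)
  then have "[:of_int a:] * A = [:of_int a:] * ip P" using a(2) by (simp only: ip_simps ip_pCons map_poly_0)
  then have AP: "A = ip P" unfolding mult_cancel_left using a(1) by simp
  have "B0 = [:b:] * C" using content_times_primitive_part[of B0] by (simp add: C_def cB)
  then have "[:of_int b:] * B = [:of_int b:] * ip C" using b(2) by (simp only: ip_simps ip_pCons map_poly_0)
  then have BC: "B = ip C" unfolding mult_cancel_left using b(1) by simp
  show ?thesis
  proof (rule that)
    show "A = ip P" by fact
    have "ip Q = (ip (P * C) :: rat poly)" using B AP BC by simp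
    then show "Q = P * C" by (simp only: ip_eq_iff)
    show "lead_coeff P = 1" using A(1) unfolding AP lead_coeff_ip by simp
    show "lead_coeff C = 1" using lB unfolding BC lead_coeff_ip by simp
  qed
qed

text \<open>The hypothesis \<open>conj\<close> is what normality and membership in a cyclotomic
  field have in common, so both claims reduce to this contradiction.\<close>

lemma conjugates_not_generated:
  fixes k :: nat
  defines "x \<equiv> complex_of_real (d k)"
  assumes k: "k \<ge> 2"
    and conj: "\<And>A z. irreducible A \<Longrightarrow> poly (rp A) x = 0 \<Longrightarrow> poly (rp A) z = 0 \<Longrightarrow> \<exists>f. z = poly (rp f) x"
  shows False
proof -
  have qx: "poly (rp (ip (q k))) x = 0" unfolding x_def rp_simps by (rule q_complex_roots(3))
  have q0: "ip (q k) \<noteq> (0 :: rat poly)" using lead_coeff_q[of k] by auto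
  obtain A where A: "lead_coeff A = 1" "irreducible A" "poly (rp A) x = 0"
    "\<And>F. poly (rp F) x = 0 \<Longrightarrow> A dvd F" using minimal_polynomial_exists[OF q0 qx] by blast
  obtain P C where PC: "A = ip P" "q k = P * C" "lead_coeff P = 1" "lead_coeff C = 1"
    using monic_rat_factor_is_int[OF A(1) A(4)[OF qx] lead_coeff_q] by blast
  have Px: "poly (ip P) x = 0" using A(3) unfolding PC(1) by simp
  define j where "j = degree C"
  have C: "C = [:- 1, 1:] ^ j" unfolding j_def
    using cofactor_eq_power[OF PC(2,4)] Px unfolding x_def .
  \<comment> \<open>If 3 divides 2k + 3 exactly once, the cofactor exceeds 1 because k >= 2 and has
    a prime factor other than 3. Otherwise any prime divisor will do.\<close>
  have "\<exists>p. prime p \<and> p dvd 2 * k + 3 \<and> (p = 3 \<longrightarrow> 9 dvd 2 * k + 3)"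
  proof (cases "3 dvd 2 * k + 3 \<and> \<not> 9 dvd 2 * k + 3")
    case True
    then obtain m where m: "2 * k + 3 = 3 * m" unfolding dvd_def by blast
    with k have "m \<noteq> 1" by auto
    then obtain p where p: "prime p" "p dvd m" using prime_factor_nat by blast
    have "\<not> 3 dvd m"
    proof
      assume "3 dvd m"
      then obtain c where "m = 3 * c" unfolding dvd_def by blast
      with m have "2 * k + 3 = 9 * c" by simp
      with True show False by simp
    qed
    then have "p \<noteq> 3" using p by auto
    with p m show ?thesis by (metis dvd_mult)
  next
    case False
    obtain p where "prime p" "p dvd 2 * k + 3" using prime_factor_nat[of "2 * k + 3"] by auto
    with False show ?thesis by blast
  qed
  then obtain p where p: "prime p" "p dvd 2 * k + 3" "p = 3 \<Longrightarrow> 9 dvd 2 * k + 3" by blast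
  have pint: "prime (int p)" using p(1) by simp
  \<comment> \<open>The cofactor is a unit at 0, so the simple root 0 modulo \<open>p\<close>
    belongs to \<open>P\<close>.\<close>
  have C0: "poly C 0 = 1 \<or> poly C 0 = - 1" unfolding C by (cases "even j") simp_all
  have "int p dvd poly P 0 * poly C 0"
    using int_p_dvd[OF p] poly_q_0[of k] unfolding PC(2) by simp
  with C0 have P0: "int p dvd poly P 0" by auto
  have P1: "\<not> int p dvd poly (pderiv P) 0"
  proof
    assume "int p dvd poly (pderiv P) 0"
    then have "int p dvd poly (pderiv (q k)) 0" using P0 unfolding PC(2) by (simp add: pderiv_mult)
    with pderiv_q_0_not_dvd[OF p] show False by blast
  qed
  obtain Z :: "complex multiset" where Z: "ip P = (\<Prod>z\<in>#Z. [:- z, 1:])"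
    using monic_complex_factorization[OF PC(3)] by metis
  obtain zs where "mset zs = Z" using ex_mset by blast
  with Z have zs: "ip P = root_poly zs" by (simp add: root_poly_def prod_mset_prod_list[symmetric])
  have min: "P dvd F" if F: "poly (ip F) x = 0" for F
  proof -
    obtain Q R where QR: "F = P * Q + R" "R = 0 \<or> degree R < degree P" by (rule monic_division[OF PC(3)])
    have "poly (rp (ip R)) x = 0" using F Px unfolding QR(1) by simp
    then have "A dvd ip R" by (rule A(4))
    then have "degree P \<le> degree R" if "R \<noteq> 0"
      using dvd_imp_degree_le[of A "ip R"] that unfolding PC(1) by simp
    then have "R = 0" using QR(2) by (metis not_le)
    then show ?thesis using QR(1) by simp
  qed
  have zconj: "\<exists>f. z = poly (rp f) x" if "z \<in> set zs" for z
  proof (rule conj[OF A(2,3)])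
    have "poly (ip P) z = 0" unfolding zs poly_root_poly using that by (auto simp: prod_list_zero_iff)
    then show "poly (rp A) z = 0" unfolding PC(1) by simp
  qed
  obtain bs where bs: "length bs = degree P" "[:int p:] dvd P - root_poly bs"
    using split_mod_prime[OF pint PC(3) P0 P1 min zs zconj] by blast
  \<comment> \<open>The factor \<open>C\<close> contributes \<open>j\<close> roots equal to 1,
    completing the splitting of \<open>P\<close> to one of \<open>q k\<close>.\<close>
  have "root_poly (replicate j 1) = [:- 1, 1 :: int:] ^ j"
    by (induction j) (simp_all del: mult_pCons_left)
  then have "q k - root_poly (bs @ replicate j 1) = (P - root_poly bs) * C"
    unfolding root_poly_append PC(2) C by (simp add: algebra_simps)
  then have "[:int p:] dvd q k - root_poly (bs @ replicate j 1)" using bs(2) by (metis dvd_mult2)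
  moreover have "length (bs @ replicate j 1) = 2 * k + 2"
  proof -
    have "P \<noteq> 0" "C \<noteq> 0" using PC by auto
    then have "degree (q k) = degree P + degree C" unfolding PC(2) by (rule degree_mult_eq)
    then show ?thesis using bs(1) degree_q[of k] by (simp add: j_def)
  qed
  ultimately show False using q_not_split_mod_p[OF p k] by blast
qed

subsection \<open>Subfields generated by one element\<close>

lemma is_subfieldD:
  assumes "is_subfield L"
  shows "0 \<in> L" "1 \<in> L" "x \<in> L \<Longrightarrow> y \<in> L \<Longrightarrow> x + y \<in> L" "x \<in> L \<Longrightarrow> y \<in> L \<Longrightarrow> x - y \<in> L"
    "x \<in> L \<Longrightarrow> y \<in> L \<Longrightarrow> x * y \<in> L" "x \<in> L \<Longrightarrow> - x \<in> L" "x \<in> L \<Longrightarrow> inverse x \<in> L"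
proof -
  show 0: "0 \<in> L" and "1 \<in> L" and "x \<in> L \<Longrightarrow> y \<in> L \<Longrightarrow> x + y \<in> L"
    and d: "\<And>x y. x \<in> L \<Longrightarrow> y \<in> L \<Longrightarrow> x - y \<in> L" and "x \<in> L \<Longrightarrow> y \<in> L \<Longrightarrow> x * y \<in> L"
    using assms by (auto simp: is_subfield_def)
  show "x \<in> L \<Longrightarrow> - x \<in> L" using d[OF 0] by force
  show "x \<in> L \<Longrightarrow> inverse x \<in> L" using assms 0 by (cases "x = 0") (auto simp: is_subfield_def)
qed

lemma is_subfield_gen_field: "is_subfield (gen_field S)"
  unfolding gen_field_def is_subfield_def by auto

lemma gen_field_superset: "x \<in> S \<Longrightarrow> x \<in> gen_field S"
  unfolding gen_field_def by auto

lemma gen_field_least: "is_subfield F \<Longrightarrow> S \<subseteq> F \<Longrightarrow> gen_field S \<subseteq> F"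
  unfolding gen_field_def by auto

lemma irreducible_rat_poly_bezout:
  fixes A g :: "rat poly"
  assumes "irreducible A" "\<not> A dvd g"
  obtains u v where "u * A + v * g = 1"
proof -
  have "coprime A g" using assms field_poly_irreducible_imp_prime prime_elem_imp_coprime by blast
  then have "gcd A g = 1" by simp
  then show ?thesis using bezout_coefficients_fst_snd[of A g] that by metis
qed

text \<open>For algebraic \<open>x\<close>, inverses come from a Bezout relation with the minimal
  polynomial.\<close>

lemma is_subfield_poly_range:
  assumes "f \<noteq> 0" "poly (rp f) x = 0"
  shows "is_subfield (range (\<lambda>f. poly (rp f) x))" (is "is_subfield ?L")
proof -
  obtain A where A: "lead_coeff A = 1" "irreducible A" "poly (rp A) x = 0" "\<And>F. poly (rp F) x = 0 \<Longrightarrow> A dvd F"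
    using minimal_polynomial_exists[OF assms] by blast
  have inv: "\<exists>f. inverse (poly (rp g) x) = poly (rp f) x" if "poly (rp g) x \<noteq> 0" for g
  proof -
    have "\<not> A dvd g"
    proof
      assume "A dvd g"
      then obtain h where "g = A * h" by (rule dvdE)
      with A(3) that show False by simp
    qed
    then obtain u v where "u * A + v * g = 1" by (rule irreducible_rat_poly_bezout[OF A(2)])
    from arg_cong[OF this, of "\<lambda>f. poly (rp f) x"] have "poly (rp v) x * poly (rp g) x = 1"
      using A(3) by simp
    then show ?thesis using that by (metis inverse_unique mult.commute)
  qed
  show ?thesis unfolding is_subfield_def
  proof (intro conjI ballI impI)
    show "0 \<in> ?L" by (rule range_eqI[of _ _ 0]) simp
    show "1 \<in> ?L" by (rule range_eqI[of _ _ 1]) simp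
    fix y assume "y \<in> ?L"
    then obtain f where f: "y = poly (rp f) x" by blast
    show "inverse y \<in> ?L" if "y \<noteq> 0" using inv that unfolding f by blast
    fix z assume "z \<in> ?L"
    then obtain g where g: "z = poly (rp g) x" by blast
    show "y + z \<in> ?L" by (rule range_eqI[of _ _ "f + g"]) (simp add: f g)
    show "y - z \<in> ?L" by (rule range_eqI[of _ _ "f - g"]) (simp add: f g)
    show "y * z \<in> ?L" by (rule range_eqI[of _ _ "f * g"]) (simp add: f g)
  qed
qed

lemma mem_poly_range: "x \<in> range (\<lambda>f. poly (rp f) x)"
  by (rule range_eqI[of _ _ "[:0, 1:]"]) simp

subsection \<open>Commuting endomorphisms and cyclotomic fields\<close>

text \<open>If the fixed field of a commuting family of endomorphisms of \<open>L\<close> is the rational field, each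
  conjugate \<open>s x\<close> is a rational polynomial in \<open>x\<close>: the interpolation polynomial sending \<open>t x\<close> to
  \<open>t (s x)\<close> for all \<open>t\<close> has invariant coefficients, because \<open>t s = s t\<close>.\<close>

locale commuting_endomorphisms =
  fixes L :: "complex set" and G :: "(complex \<Rightarrow> complex) set"
  assumes subfield: "is_subfield L"
    and closed: "s \<in> G \<Longrightarrow> x \<in> L \<Longrightarrow> s x \<in> L"
    and hom_add: "s \<in> G \<Longrightarrow> x \<in> L \<Longrightarrow> y \<in> L \<Longrightarrow> s (x + y) = s x + s y"
    and hom_mult: "s \<in> G \<Longrightarrow> x \<in> L \<Longrightarrow> y \<in> L \<Longrightarrow> s (x * y) = s x * s y"
    and hom_one: "s \<in> G \<Longrightarrow> s 1 = 1"
    and commute: "s \<in> G \<Longrightarrow> t \<in> G \<Longrightarrow> x \<in> L \<Longrightarrow> s (t x) = t (s x)"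
    and comp: "s \<in> G \<Longrightarrow> t \<in> G \<Longrightarrow> \<exists>r\<in>G. \<forall>x\<in>L. s (t x) = r x"
    and ident: "\<exists>e\<in>G. \<forall>x\<in>L. e x = x"
    and fixed: "x \<in> L \<Longrightarrow> (\<And>s. s \<in> G \<Longrightarrow> s x = x) \<Longrightarrow> x \<in> range of_rat"
begin

lemmas L = is_subfieldD[OF subfield]

definition L_polys :: "complex poly set" where
  "L_polys = {p. \<forall>i. coeff p i \<in> L}"

lemma hom_zero: "s \<in> G \<Longrightarrow> s 0 = 0"
  using hom_add[of s 0 0] L(1) by simp

lemma hom_uminus: "s \<in> G \<Longrightarrow> x \<in> L \<Longrightarrow> s (- x) = - s x"
  using hom_add[of s x "- x"] hom_zero[of s] L(6)[of x] by (simp add: eq_neg_iff_add_eq_0 add.commute)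

lemma sum_in_L: "(\<And>i. i \<in> I \<Longrightarrow> f i \<in> L) \<Longrightarrow> sum f I \<in> L"
  by (induction I rule: infinite_finite_induct) (auto intro: L)

lemma prod_in_L: "(\<And>i. i \<in> I \<Longrightarrow> f i \<in> L) \<Longrightarrow> prod f I \<in> L"
  by (induction I rule: infinite_finite_induct) (auto intro: L)

lemma hom_sum: "s \<in> G \<Longrightarrow> (\<And>i. i \<in> I \<Longrightarrow> f i \<in> L) \<Longrightarrow> s (sum f I) = (\<Sum>i\<in>I. s (f i))"
  by (induction I rule: infinite_finite_induct) (auto simp: hom_zero hom_add sum_in_L)

lemma inj_on_L:
  assumes s: "s \<in> G"
  shows "inj_on s L"
proof (rule inj_onI)
  fix x y assume xy: "x \<in> L" "y \<in> L" "s x = s y"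
  have "s (x - y) = 0" using hom_add[OF s xy(1) L(6)[OF xy(2)]] hom_uminus[OF s xy(2)] xy(3) by simp
  moreover have "x - y \<in> L" using xy L by simp
  ultimately have "s ((x - y) * inverse (x - y)) = 0" using hom_mult[OF s] L(7) by simp
  then have "x - y = 0" using hom_one[OF s] by (metis right_inverse zero_neq_one)
  then show "x = y" by simp
qed

lemma L_polys_add: "p \<in> L_polys \<Longrightarrow> r \<in> L_polys \<Longrightarrow> p + r \<in> L_polys"
  by (simp add: L_polys_def L)

lemma L_polys_mult: "p \<in> L_polys \<Longrightarrow> r \<in> L_polys \<Longrightarrow> p * r \<in> L_polys"
  by (simp add: L_polys_def coeff_mult sum_in_L L)

lemma L_polys_pCons: "a \<in> L \<Longrightarrow> p \<in> L_polys \<Longrightarrow> pCons a p \<in> L_polys"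
  by (simp add: L_polys_def coeff_pCons split: nat.split)

lemma L_polys_0: "0 \<in> L_polys"
  by (simp add: L_polys_def L)

lemma L_polys_1: "1 \<in> L_polys"
  unfolding one_pCons by (intro L_polys_pCons L_polys_0 L)

lemma L_polys_prod: "(\<And>i. i \<in> I \<Longrightarrow> f i \<in> L_polys) \<Longrightarrow> prod f I \<in> L_polys"
  by (induction I rule: infinite_finite_induct) (auto intro: L_polys_1 L_polys_mult)

lemma poly_in_L:
  assumes "p \<in> L_polys" "x \<in> L"
  shows "poly p x \<in> L"
proof -
  have "x ^ n \<in> L" for n by (induction n) (auto intro: L assms)
  then show ?thesis using assms(1) unfolding poly_altdef L_polys_def by (intro sum_in_L L) auto
qed

lemma poly_map_poly:
  assumes s: "s \<in> G" and "p \<in> L_polys" "x \<in> L"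
  shows "poly (map_poly s p) (s x) = s (poly p x)"
  using assms(2)
proof (induction p)
  case 0
  then show ?case by (simp add: hom_zero[OF s])
next
  case (pCons a p)
  have all: "coeff (pCons a p) i \<in> L" for i using pCons.prems by (simp add: L_polys_def)
  have a: "a \<in> L" using all[of 0] by simp
  have "coeff p i \<in> L" for i using all[of "Suc i"] by simp
  then have p: "p \<in> L_polys" by (simp add: L_polys_def)
  have "poly (map_poly s (pCons a p)) (s x) = s a + s x * s (poly p x)"
    using pCons.IH[OF p] by (simp add: map_poly_pCons hom_zero[OF s])
  also have "\<dots> = s (a + x * poly p x)"
    using a assms(3) poly_in_L[OF p assms(3)] L by (simp add: hom_add[OF s] hom_mult[OF s])
  finally show ?case by simp
qed

lemma map_poly_mult_LP:
  assumes s: "s \<in> G" and "p \<in> L_polys" "r \<in> L_polys"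
  shows "map_poly s (p * r) = map_poly s p * map_poly s r"
proof (rule poly_eqI)
  fix n
  show "coeff (map_poly s (p * r)) n = coeff (map_poly s p * map_poly s r) n"
    using assms(2,3) L unfolding L_polys_def
    by (simp add: coeff_map_poly hom_zero[OF s] coeff_mult hom_sum[OF s] hom_mult[OF s])
qed

lemma map_poly_prod_roots:
  assumes s: "s \<in> G" and T: "finite T" "T \<subseteq> L"
  shows "map_poly s (\<Prod>t\<in>T. [:- t, 1:]) = (\<Prod>t\<in>T. [:- s t, 1:])"
  using T
proof (induction T)
  case empty
  then show ?case using hom_one[OF s] hom_zero[OF s] by (simp add: one_pCons map_poly_pCons)
next
  case (insert t T)
  have 1: "[:- t, 1:] \<in> L_polys" if "t \<in> L" for t using that by (intro L_polys_pCons L_polys_0 L)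
  have "map_poly s [:- t, 1:] = [:- s t, 1:]" using insert.prems
    by (simp add: map_poly_pCons hom_zero[OF s] hom_one[OF s] hom_uminus[OF s])
  moreover have "(\<Prod>t\<in>T. [:- t, 1:]) \<in> L_polys" using insert.prems 1 by (intro L_polys_prod) auto
  ultimately show ?case using insert 1 by (simp add: map_poly_mult_LP[OF s] del: mult_pCons_left)
qed

lemma fixed_poly_is_rational:
  assumes "p \<in> L_polys" "\<And>s. s \<in> G \<Longrightarrow> map_poly s p = p"
  obtains f where "p = rp f"
proof -
  have "coeff p i \<in> range of_rat" for i
  proof (rule fixed)
    show "coeff p i \<in> L" using assms(1) by (simp add: L_polys_def)
    show "s (coeff p i) = coeff p i" if "s \<in> G" for s
      using arg_cong[OF assms(2)[OF that], of "\<lambda>p. coeff p i"] by (simp add: coeff_map_poly hom_zero[OF that])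
  qed
  then have "\<forall>i. \<exists>r. coeff p i = of_rat r" by blast
  then obtain r where r: "\<And>i. coeff p i = of_rat (r i)" by metis
  define f where "f = Abs_poly r"
  have "r i = 0" if "i > degree p" for i using r[of i] coeff_eq_0[OF that] by simp
  then have "coeff f = r" unfolding f_def by (intro Abs_poly_inverse) (auto simp: MOST_nat)
  then have "p = rp f" by (intro poly_eqI) (simp add: coeff_map_poly r)
  then show ?thesis by (rule that)
qed

text \<open>Newton interpolation, which stays inside the field \<open>L\<close>. Bounding the degree
  through coefficients also covers empty \<open>T\<close>, where the polynomial is 0.\<close>

lemma interpolation:
  assumes "finite T" "T \<subseteq> L" "\<And>t. t \<in> T \<Longrightarrow> v t \<in> L"
  shows "\<exists>p\<in>L_polys. (\<forall>i\<ge>card T. coeff p i = 0) \<and> (\<forall>t\<in>T. poly p t = v t)"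
  using assms
proof (induction T)
  case empty
  then show ?case by (intro bexI[of _ 0]) (auto intro: L_polys_0)
next
  case (insert t T)
  then obtain p where p: "p \<in> L_polys" "\<forall>i\<ge>card T. coeff p i = 0" "\<forall>t\<in>T. poly p t = v t" by auto
  let ?w = "\<Prod>s\<in>T. [:- s, 1:]"
  define c where "c = (v t - poly p t) * inverse (\<Prod>s\<in>T. t - s)"
  have w: "poly ?w x = (\<Prod>s\<in>T. x - s)" for x by (simp add: poly_prod)
  have tL: "t \<in> L" "T \<subseteq> L" using insert.prems by auto
  have cL: "c \<in> L" unfolding c_def
    using insert.prems tL by (intro L prod_in_L poly_in_L p) auto
  have wL: "?w \<in> L_polys" using tL(2) by (intro L_polys_prod L_polys_pCons L_polys_0 L) auto
  have deg: "degree ?w = card T" by (subst degree_prod_eq_sum_degree) auto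
  have "(\<Prod>s\<in>T. t - s) \<noteq> 0" using insert.hyps by auto
  then have ct: "c * (\<Prod>s\<in>T. t - s) = v t - poly p t" by (simp add: c_def)
  show ?case
  proof (intro bexI[of _ "p + [:c:] * ?w"] conjI)
    show "p + [:c:] * ?w \<in> L_polys" by (intro L_polys_add L_polys_mult L_polys_pCons L_polys_0 p wL cL)
    show "\<forall>i\<ge>card (insert t T). coeff (p + [:c:] * ?w) i = 0"
      using insert.hyps p(2) by (auto simp: coeff_eq_0 deg)
    show "\<forall>s\<in>insert t T. poly (p + [:c:] * ?w) s = v s"
      using p(3) ct insert.hyps by (auto simp: w)
  qed
qed

lemma conjugate_is_polynomial:
  assumes x: "x \<in> L" and fin: "finite ((\<lambda>s. s x) ` G)"
    and A: "\<And>F. poly (rp F) x = 0 \<Longrightarrow> A dvd F" and z: "poly (rp A) z = 0"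
  shows "\<exists>f. z = poly (rp f) x"
proof -
  define T where "T = (\<lambda>s. s x) ` G"
  have T: "finite T" "T \<subseteq> L" using fin x closed by (auto simp: T_def)
  obtain e where "e \<in> G" "e x = x" using ident x by blast
  then have xT: "x \<in> T" unfolding T_def by (metis image_eqI)
  \<comment> \<open>The orbit is finite and closed under \<open>G\<close>, and endomorphisms of a
    field are injective.\<close>
  have perm: "s ` T = T" if s: "s \<in> G" for s
  proof (rule endo_inj_surj)
    show "s ` T \<subseteq> T"
    proof
      fix y assume "y \<in> s ` T"
      then obtain t where t: "t \<in> G" "y = s (t x)" by (auto simp: T_def)
      then obtain r where "r \<in> G" "y = r x" using comp[OF s t(1)] x by auto
      then show "y \<in> T" by (auto simp: T_def)
    qed
    show "inj_on s T" using inj_on_L[OF s] T(2) inj_on_subset by blast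
  qed (rule T)
  \<comment> \<open>The orbit polynomial is invariant, hence rational and divisible by
    \<open>A\<close>; so \<open>z\<close> lies in the orbit.\<close>
  let ?R = "\<Prod>t\<in>T. [:- t, 1:]"
  have "?R \<in> L_polys" using T(2) by (intro L_polys_prod L_polys_pCons L_polys_0 L) auto
  moreover have "map_poly s ?R = ?R" if s: "s \<in> G" for s
  proof -
    have "inj_on s T" using inj_on_L[OF s] T(2) inj_on_subset by blast
    then have "(\<Prod>t\<in>s ` T. [:- t, 1:]) = (\<Prod>t\<in>T. [:- s t, 1:])" by (simp add: prod.reindex)
    then show ?thesis unfolding map_poly_prod_roots[OF s T] perm[OF s] by simp
  qed
  ultimately obtain R where R: "?R = rp R" by (rule fixed_poly_is_rational)
  have ev: "poly (rp R) y = (\<Prod>t\<in>T. y - t)" for y unfolding R[symmetric] by (simp add: poly_prod)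
  have "poly (rp R) x = 0" unfolding ev using xT T(1) by auto
  then have "A dvd R" by (rule A)
  then obtain B where "R = A * B" by (rule dvdE)
  then have "poly (rp R) z = 0" using z by simp
  then have "z \<in> T" unfolding ev using T(1) by auto
  then obtain s where s: "s \<in> G" "z = s x" by (auto simp: T_def)
  obtain p where p: "p \<in> L_polys" "\<forall>i\<ge>card T. coeff p i = 0" "\<forall>t\<in>T. poly p t = s t"
    using interpolation[OF T, of s] closed[OF s(1)] T(2) by blast
  have T0: "card T > 0" using xT T(1) by (auto simp: card_gt_0_iff)
  have deg: "degree p < card T" if "\<forall>i\<ge>card T. coeff p i = 0" for p :: "complex poly"
    using that T0 by (metis leading_coeff_0_iff degree_0 not_le)
  \<comment> \<open>Both polynomials have degree below the orbit size and agree on the orbit: at r t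
    the left one gives r (s t) = s (r t).\<close>
  have "map_poly r p = p" if r: "r \<in> G" for r
  proof (rule poly_eqI_degree)
    show "degree p < card T" by (rule deg[OF p(2)])
    show "degree (map_poly r p) < card T" using p(2) by (intro deg) (simp add: coeff_map_poly hom_zero[OF r])
    fix y assume "y \<in> T"
    then obtain t where t: "t \<in> T" "y = r t" using perm[OF r] by blast
    have "poly (map_poly r p) y = r (s t)" unfolding t(2) using poly_map_poly[OF r p(1)] t(1) T(2) p(3) by auto
    also have "\<dots> = s y" unfolding t(2) using commute[OF r s(1)] t(1) T(2) by auto
    finally show "poly (map_poly r p) y = poly p y" using p(3) \<open>y \<in> T\<close> by simp
  qed
  then obtain f where "p = rp f" using fixed_poly_is_rational[OF p(1)] by blast
  then show ?thesis using p(3) xT s(2) by metis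
qed

end

section \<open>Conjugates of elements of a cyclotomic field\<close>

lemma irreducible_rat_poly_dvd:
  fixes x :: complex
  assumes "irreducible A" "poly (rp A) x = 0" "poly (rp F) x = 0"
  shows "A dvd F"
proof (rule ccontr)
  assume "\<not> A dvd F"
  then obtain u v where "u * A + v * F = 1" by (rule irreducible_rat_poly_bezout[OF assms(1)])
  from arg_cong[OF this, of "\<lambda>f. poly (rp f) x"] show False using assms(2,3) by simp
qed

lemma poly_rp_pcompose_monom: "poly (rp (pcompose f (monom 1 j))) z = poly (rp f) (z ^ j)"
proof (induction f)
  case (pCons a f)
  have "rp (monom 1 j) = monom 1 j" by (simp add: map_poly_monom)
  with pCons show ?case by (simp add: pcompose_pCons poly_monom)
qed simp

lemma cyclotomic_conjugate_is_polynomial: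
  assumes n: "n \<ge> 1" and x: "x \<in> cyclotomic_field n"
    and A: "irreducible A" "poly (rp A) x = 0" and z: "poly (rp A) z = 0"
  shows "\<exists>f. z = poly (rp f) x"
proof -
  define \<zeta> where "\<zeta> = cis (2 * pi / real n)"
  define u :: "rat poly" where "u = monom 1 n - 1"
  have rpu: "rp u = monom 1 n - 1" unfolding u_def by (simp only: rp_simps) (simp add: map_poly_monom)
  have evu: "poly (rp u) w = w ^ n - 1" for w unfolding rpu by (simp add: poly_monom)
  have powers: "\<exists>j. w = \<zeta> ^ j" if "w ^ n = 1" for w
  proof -
    have "w \<in> (\<lambda>k. cis (2 * pi * real k / real n)) ` {..<n}"
      using bij_betw_roots_unity[of n] n that by (auto simp: bij_betw_def)
    then obtain j where "w = cis (2 * pi * real j / real n)" by blast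
    then have "w = \<zeta> ^ j" by (simp add: \<zeta>_def DeMoivre mult_ac)
    then show ?thesis by blast
  qed
  have "\<zeta> ^ n = 1" using n by (simp add: \<zeta>_def DeMoivre)
  then have u\<zeta>: "poly (rp u) \<zeta> = 0" by (simp add: evu)
  have u0: "u \<noteq> 0"
  proof
    assume "u = 0"
    then have "poly (rp u) 0 = 0" by simp
    then show False using n unfolding evu by (simp add: power_0_left)
  qed
  obtain \<Phi> where \<Phi>: "lead_coeff \<Phi> = 1" "irreducible \<Phi>" "poly (rp \<Phi>) \<zeta> = 0" "\<And>F. poly (rp F) \<zeta> = 0 \<Longrightarrow> \<Phi> dvd F"
    using minimal_polynomial_exists[OF u0 u\<zeta>] by blast
  define S where "S = {w. poly (rp \<Phi>) w = 0}"
  obtain \<Psi> where \<Psi>: "u = \<Phi> * \<Psi>" using \<Phi>(4)[OF u\<zeta>] by (rule dvdE)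
  have degrp: "degree (rp f) = degree f" for f by (rule degree_map_poly) simp
  have rp0: "rp f \<noteq> 0" if "f \<noteq> 0" for f using that by (simp add: map_poly_eq_0_iff)
  have nz: "\<Phi> \<noteq> 0" "\<Psi> \<noteq> 0" using u0 \<Psi> by auto
  have degu: "degree u = n"
  proof -
    have "degree (monom 1 n + (- 1) :: rat poly) = degree (monom 1 n :: rat poly)"
      using n by (intro degree_add_eq_left) (simp add: degree_monom_eq)
    then show ?thesis by (simp add: u_def degree_monom_eq)
  qed
  have finS: "finite S" unfolding S_def using rp0[OF nz(1)] by (rule poly_roots_finite)
  have S: "w \<in> S \<Longrightarrow> \<exists>j. w = \<zeta> ^ j" for w
  proof -
    assume "w \<in> S"
    then have "poly (rp u) w = 0" unfolding \<Psi> S_def by simp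
    then show ?thesis using powers by (simp add: evu)
  qed
  \<comment> \<open>Separability by counting: the n distinct roots of unity are covered by the roots
    of \<open>\<Phi>\<close> and of \<open>\<Psi>\<close>, whose degrees add up to n.\<close>
  have cardS: "degree \<Phi> \<le> card S"
  proof -
    have "{w :: complex. w ^ n = 1} \<subseteq> S \<union> {w. poly (rp \<Psi>) w = 0}"
    proof
      fix w :: complex assume "w \<in> {w. w ^ n = 1}"
      then have "poly (rp (\<Phi> * \<Psi>)) w = 0" unfolding \<Psi>[symmetric] evu by simp
      then show "w \<in> S \<union> {w. poly (rp \<Psi>) w = 0}" by (simp add: S_def)
    qed
    moreover have fin: "finite {w. poly (rp \<Psi>) w = 0}" using rp0[OF nz(2)] by (rule poly_roots_finite)
    ultimately have "card {w :: complex. w ^ n = 1} \<le> card (S \<union> {w. poly (rp \<Psi>) w = 0})"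
      using finS by (intro card_mono) auto
    also have "\<dots> \<le> card S + card {w. poly (rp \<Psi>) w = 0}" by (rule card_Un_le)
    also have "\<dots> \<le> card S + degree \<Psi>" using card_poly_roots_bound[OF rp0[OF nz(2)]] by (simp add: degrp)
    finally have "n \<le> card S + degree \<Psi>" using n by (simp add: card_roots_unity_eq)
    moreover have "n = degree \<Phi> + degree \<Psi>" using degu nz unfolding \<Psi> by (simp add: degree_mult_eq)
    ultimately show ?thesis by simp
  qed
  have deg0: "degree \<Phi> > 0"
  proof (rule ccontr)
    assume "\<not> degree \<Phi> > 0"
    then obtain c where "\<Phi> = [:c:]" by (auto elim: degree_eq_zeroE)
    with \<Phi>(3) nz show False by simp
  qed
  define L where "L = range (\<lambda>f. poly (rp f) \<zeta>)"
  define J where "J = {j. \<zeta> ^ j \<in> S}"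
  \<comment> \<open>The endomorphism sending \<open>\<zeta>\<close> to \<open>\<zeta> ^ j\<close>.
    The chosen representative is immaterial for \<open>j\<close> in \<open>J\<close>, because
    \<open>\<Phi>\<close> divides every rational polynomial vanishing at
    \<open>\<zeta>\<close>.\<close>
  define \<sigma> where "\<sigma> j y = poly (rp (SOME f. y = poly (rp f) \<zeta>)) (\<zeta> ^ j)" for j y
  have root: "poly (rp f) (\<zeta> ^ j) = 0" if j: "j \<in> J" "poly (rp f) \<zeta> = 0" for f j
  proof -
    obtain g where "f = \<Phi> * g" using \<Phi>(4)[OF j(2)] by (rule dvdE)
    then show ?thesis using j(1) by (simp add: J_def S_def)
  qed
  have \<sigma>: "\<sigma> j (poly (rp f) \<zeta>) = poly (rp f) (\<zeta> ^ j)" if "j \<in> J" for f j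
  proof -
    let ?g = "SOME g. poly (rp f) \<zeta> = poly (rp g) \<zeta>"
    have "poly (rp f) \<zeta> = poly (rp ?g) \<zeta>" by (rule someI) (rule refl)
    then have "poly (rp (f - ?g)) (\<zeta> ^ j) = 0" by (intro root that) simp
    then show ?thesis by (simp add: \<sigma>_def)
  qed
  \<comment> \<open>\<open>\<Phi>\<close> composed with the j-th power vanishes at
    \<open>\<zeta>\<close>, hence also at \<open>\<zeta> ^ i\<close>.\<close>
  have mul: "i * j \<in> J" if "i \<in> J" "j \<in> J" for i j
  proof -
    have "poly (rp (pcompose \<Phi> (monom 1 j))) \<zeta> = 0"
      unfolding poly_rp_pcompose_monom using that(2) by (simp add: J_def S_def)
    from root[OF that(1) this] show ?thesis
      unfolding poly_rp_pcompose_monom by (simp add: J_def S_def power_mult)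
  qed
  have \<sigma>2: "\<sigma> i (\<sigma> j (poly (rp f) \<zeta>)) = poly (rp f) (\<zeta> ^ (i * j))" if "i \<in> J" "j \<in> J" for i j f
  proof -
    have "\<sigma> i (\<sigma> j (poly (rp f) \<zeta>)) = \<sigma> i (poly (rp (pcompose f (monom 1 j))) \<zeta>)"
      unfolding \<sigma>[OF that(2)] poly_rp_pcompose_monom ..
    also have "\<dots> = poly (rp f) (\<zeta> ^ (i * j))"
      by (rule trans[OF \<sigma>[OF that(1)]]) (simp only: poly_rp_pcompose_monom power_mult)
    finally show ?thesis .
  qed
  have one: "1 \<in> J" using \<Phi>(3) by (simp add: J_def S_def)
  interpret commuting_endomorphisms L "\<sigma> ` J"
  proof
    show "is_subfield L" unfolding L_def by (rule is_subfield_poly_range[OF u0 u\<zeta>])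
    fix s assume "s \<in> \<sigma> ` J"
    then obtain i where i: "i \<in> J" "s = \<sigma> i" by blast
    show "s 1 = 1" using \<sigma>[OF i(1), of 1] by (simp add: i(2))
    fix y assume "y \<in> L"
    then obtain f where f: "y = poly (rp f) \<zeta>" by (auto simp: L_def)
    show "s y \<in> L" unfolding i(2) f \<sigma>[OF i(1)] poly_rp_pcompose_monom[symmetric] L_def by blast
    {
      fix y' assume "y' \<in> L"
      then obtain g where g: "y' = poly (rp g) \<zeta>" by (auto simp: L_def)
      show "s (y + y') = s y + s y'" using \<sigma>[OF i(1), of "f + g"] \<sigma>[OF i(1)] by (simp add: i(2) f g)
      show "s (y * y') = s y * s y'" using \<sigma>[OF i(1), of "f * g"] \<sigma>[OF i(1)] by (simp add: i(2) f g)
    }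
    fix t assume "t \<in> \<sigma> ` J"
    then obtain j where j: "j \<in> J" "t = \<sigma> j" by blast
    show "s (t y) = t (s y)" unfolding i(2) j(2) f using \<sigma>2[OF i(1) j(1)] \<sigma>2[OF j(1) i(1)]
      by (simp add: mult.commute)
  next
    fix s t assume "s \<in> \<sigma> ` J" "t \<in> \<sigma> ` J"
    then obtain i j where ij: "i \<in> J" "s = \<sigma> i" "j \<in> J" "t = \<sigma> j" by blast
    show "\<exists>r\<in>\<sigma> ` J. \<forall>y\<in>L. s (t y) = r y"
      using \<sigma>2[OF ij(1,3)] \<sigma>[OF mul[OF ij(1,3)]] mul[OF ij(1,3)] unfolding ij L_def
      by (intro bexI[of _ "\<sigma> (i * j)"]) auto
  next
    show "\<exists>e\<in>\<sigma> ` J. \<forall>y\<in>L. e y = y" using one \<sigma>[OF one] unfolding L_def by (intro bexI[of _ "\<sigma> 1"]) auto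
  next
    fix y assume y: "y \<in> L" and inv: "\<And>s. s \<in> \<sigma> ` J \<Longrightarrow> s y = y"
    then obtain f where f: "y = poly (rp f) \<zeta>" by (auto simp: L_def)
    define g where "g = f mod \<Phi>"
    have fg: "f = \<Phi> * (f div \<Phi>) + g" by (simp add: g_def)
    have ev: "poly (rp f) w = poly (rp g) w" if "w \<in> S" for w
      using that arg_cong[OF fg, of "\<lambda>f. poly (rp f) w"] by (simp add: S_def)
    \<comment> \<open>The reduced representative takes the value \<open>y\<close> at all roots of
      \<open>\<Phi>\<close>. These are more than its degree, so it is constant and \<open>y\<close>
      is rational.\<close>
    have "rp g = [:y:]"
    proof (rule poly_eqI_degree)
      show "degree (rp g) < card S" using degree_mod_less'[of \<Phi> f] deg0 nz cardS
        by (cases "g = 0") (auto simp: degrp g_def)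
      show "degree [:y:] < card S" using deg0 cardS by simp
      fix w assume w: "w \<in> S"
      then obtain j where j: "w = \<zeta> ^ j" using S by blast
      with w have jJ: "j \<in> J" by (simp add: J_def)
      then have "poly (rp f) w = y" using inv[of "\<sigma> j"] \<sigma>[OF jJ, of f] by (simp add: f j)
      then show "poly (rp g) w = poly [:y:] w" using ev[OF w] by simp
    qed
    then have "y = of_rat (coeff g 0)" by (metis coeff_map_poly coeff_pCons_0 of_rat_0)
    then show "y \<in> range of_rat" by blast
  qed
  have "gen_field {\<zeta>} \<subseteq> L" unfolding L_def
    using is_subfield_poly_range[OF u0 u\<zeta>] mem_poly_range[of \<zeta>] by (intro gen_field_least) auto
  then have xL: "x \<in> L" using x by (auto simp: cyclotomic_field_def \<zeta>_def)
  then obtain f where f: "x = poly (rp f) \<zeta>" by (auto simp: L_def)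
  show ?thesis
  proof (rule conjugate_is_polynomial[OF xL _ irreducible_rat_poly_dvd[OF A] z])
    \<comment> \<open>The exponents in \<open>J\<close> are arbitrary naturals, but the image of
      \<open>x\<close> depends only on the power \<open>\<zeta> ^ j\<close>, which lies in the
      finite set \<open>S\<close>.\<close>
    have "(\<lambda>s. s x) ` \<sigma> ` J \<subseteq> (\<lambda>w. poly (rp f) w) ` S"
      using \<sigma> by (auto simp: f J_def)
    then show "finite ((\<lambda>s. s x) ` \<sigma> ` J)" using finS finite_surj by blast
  qed
qed

theorem mainTheorem9:
  fixes k :: nat
  assumes "k \<ge> 2"
  shows "\<not> galois_over_Q (gen_field {complex_of_real (d k)})
         \<and> \<not> galois_over_Q (gen_field {complex_of_real (d k - 2)})
         \<and> (\<forall>n::nat. n \<ge> 1 \<longrightarrow> complex_of_real (d k) \<notin> cyclotomic_field n)"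
proof -
  let ?x = "complex_of_real (d k)"
  have "ip (q k) \<noteq> (0 :: rat poly)" using lead_coeff_q[of k] by auto
  moreover have "poly (rp (ip (q k))) ?x = 0" unfolding rp_simps by (rule q_complex_roots(3))
  ultimately have L: "is_subfield (range (\<lambda>f. poly (rp f) ?x))" (is "is_subfield ?L")
    by (rule is_subfield_poly_range)
  \<comment> \<open>Allowing any \<open>K\<close> between the generator and its field treats
    \<open>d k\<close> and \<open>d k - 2\<close> together.\<close>
  have not_galois: "\<not> galois_over_Q K" if "?x \<in> K" "K \<subseteq> ?L" for K
  proof
    assume "galois_over_Q K"
    then have "normal_over_Q K" by (simp add: galois_over_Q_def)
    then have "\<exists>f. z = poly (rp f) ?x" if "irreducible A" "poly (rp A) ?x = 0" "poly (rp A) z = 0" for A z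
      using that \<open>?x \<in> K\<close> \<open>K \<subseteq> ?L\<close> unfolding normal_over_Q_def by blast
    with conjugates_not_generated[OF assms] show False by blast
  qed
  have xL: "?x \<in> ?L" by (rule mem_poly_range)
  have "\<not> galois_over_Q (gen_field {?x})"
    using gen_field_superset[of ?x "{?x}"] gen_field_least[OF L] xL by (intro not_galois) auto
  moreover have "\<not> galois_over_Q (gen_field {complex_of_real (d k - 2)})"
  proof (rule not_galois)
    let ?K = "gen_field {complex_of_real (d k - 2)}"
    note K = is_subfieldD[OF is_subfield_gen_field[of "{complex_of_real (d k - 2)}"]]
    have "complex_of_real (d k - 2) + (1 + 1) \<in> ?K" by (intro K gen_field_superset) simp
    then show "?x \<in> ?K" by simp
    have "?x - (1 + 1) \<in> ?L" by (intro is_subfieldD[OF L] xL)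
    then show "?K \<subseteq> ?L" by (intro gen_field_least[OF L]) simp
  qed
  moreover have "?x \<notin> cyclotomic_field n" if "n \<ge> 1" for n
    using conjugates_not_generated[OF assms] cyclotomic_conjugate_is_polynomial[OF that] by blast
  ultimately show ?thesis by blast
qed

end
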